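(* Let $K$ be a finite field, let $S=K[t_1,\ldots,t_s]$, let $X=\{P_1,\ldots,P_m\}$ be a subset of $K^s$ with $|X|\geq 2$, let $I=I(X)$ be its vanishing ideal, let $r_0$ be the regularity index of $H_I^a$, and let $\prec$ be a graded monomial order on $S$. Assume $\mathrm{char}(K)=2$, $r_0$ is odd, and $I$ is Gorenstein. Define $\alpha=(\alpha_1,\ldots,\alpha_m)\in(K^* )^m$ by $\alpha_i^2=\mathrm{lc}(f_i)$, where $\mathrm{lc}(f_i)$ is the leading coefficient of the $i$-th standard indicator function $f_i$ for $P_i$. Then the linear code $\alpha\cdot C_X((r_0-1)/2)$ is self-dual.
   Context: $I(X)$ is the ideal of all polynomials vanishing on $X$. A graded monomial order compares monomials first by total degree; leading coefficients are with respect to $\prec$. $\Delta_\prec(I)$ is the set of standard monomials of $S/I$ (monomials not in $\mathrm{in}_\prec(I)$), and $K\Delta_\prec(I)$ is its $K$-span. The $i$-th standard indicator function $f_i$ is the unique polynomial in $K\Delta_\prec(I)$ with $f_i(P_i)=1$ and $f_i(P_j)=0$ for $j\neq i$. $S_{\le d}$ is the space of polynomials of total degree at most $d$; $I_{\le d}=I\cap S_{\le d}$; $H_I^a(d)=\dim_K(S_{\le d}/I_{\le d})$. The regularity index $r_0$ of $H_I^a$ is the least integer $\ell\ge 0$ with $H_I^a(d)=|X|$ for all $d\ge\ell$. $C_X(d)=\{(f(P_1),\ldots,f(P_m)): f\in S_{\le d}\}\subset K^m$. For a linear code $C\subset K^m$, $\alpha\cdot C=\{(\alpha_1c_1,\ldots,\alpha_mc_m):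 c\in C\}$; $C$ is self-dual if $C=C^\perp$, the dual being with respect to the ordinary inner product. Gorenstein convention: let $u$ be a new variable; for $f\in S$ of degree $e$ let $f^h=u^e f(t_1/u,\ldots,t_s/u)$, and let $I^h=(\{f^h: f\in I\})\subset S[u]$ (standard grading). $I=I(X)$ is called Gorenstein if $S[u]/I^h$ is a Gorenstein graded ring, i.e. it is Cohen--Macaulay and the last Betti number in its minimal graded free resolution over $S[u]$ equals $1$. *)

theory Defs
  imports
    "HOL-Library.Poly_Mapping"
    "HOL-Library.Extended_Nat"
    "HOL-Library.FuncSet"
    "Jordan_Normal_Form.Matrix_Kernel"
begin

section \<open>Polynomials in finitely many variables\<close>

text \<open>The variables are the elements of a finite type \<open>'x\<close>: a monomial is its exponent vector and a
  polynomial is a finitely supported function from monomials to coefficients, so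
  \<open>('x, 'k) mpol\<close> is the polynomial ring over \<open>'k\<close> in \<open>CARD('x)\<close> variables. Points of affine space
  and codewords are functions from the respective finite index type to \<open>'k\<close>.\<close>

type_synonym 'x mon = "'x \<Rightarrow>\<^sub>0 nat"
type_synonym ('x, 'k) mpol = "('x \<Rightarrow>\<^sub>0 nat) \<Rightarrow>\<^sub>0 'k"

definition mdeg :: "'x::finite mon \<Rightarrow> nat" where
  "mdeg m = (\<Sum>x\<in>UNIV. Poly_Mapping.lookup m x)"

text \<open>The total degree; the zero polynomial gets degree 0.\<close>

definition tdeg :: "('x::finite, 'k::zero) mpol \<Rightarrow> nat" where
  "tdeg f = (if f = 0 then 0 else Max (mdeg ` Poly_Mapping.keys f))"

definition eval_mpol :: "('x::finite, 'k::comm_ring_1) mpol \<Rightarrow> ('x \<Rightarrow> 'k) \<Rightarrow> 'k" where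
  "eval_mpol f p = (\<Sum>m\<in>Poly_Mapping.keys f. Poly_Mapping.lookup f m * (\<Prod>x\<in>UNIV. p x ^ Poly_Mapping.lookup m x))"

definition var :: "'x \<Rightarrow> ('x, 'k::comm_ring_1) mpol" where
  "var x = Poly_Mapping.single (Poly_Mapping.single x 1) 1"

definition pscale :: "'k::comm_ring_1 \<Rightarrow> ('x, 'k) mpol \<Rightarrow> ('x, 'k) mpol" where
  "pscale c f = Poly_Mapping.single 0 c * f"

text \<open>The qualifier \<open>Modules\<close> refers to the type-class based modules of \<open>HOL.Modules\<close>, not to
  those of \<open>HOL-Algebra\<close>. A ring is a module over itself, whose submodules are the ideals.\<close>

lemma module_self: "Modules.module ((*) :: 'r::comm_ring_1 \<Rightarrow> 'r \<Rightarrow> 'r)"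
  by unfold_locales (simp_all add: algebra_simps)

lemma vector_space_pscale:
  "Vector_Spaces.vector_space (pscale :: 'k::field \<Rightarrow> ('x, 'k) mpol \<Rightarrow> ('x, 'k) mpol)"
  by unfold_locales
    (simp_all add: pscale_def single_add algebra_simps mult_single flip: mult.assoc)

abbreviation is_ideal :: "'r::comm_ring_1 set \<Rightarrow> bool" where
  "is_ideal \<equiv> Modules.module.subspace (*)"

abbreviation ideal_gen :: "'r::comm_ring_1 set \<Rightarrow> 'r set" where
  "ideal_gen \<equiv> Modules.module.span (*)"

abbreviation linear_span :: "('x, 'k::field) mpol set \<Rightarrow> ('x, 'k) mpol set" where
  "linear_span \<equiv> Modules.module.span pscale"

definition vanishing_ideal :: "('x::finite \<Rightarrow> 'k::field) set \<Rightarrow> ('x, 'k) mpol set" where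
  "vanishing_ideal X = {f. \<forall>p\<in>X. eval_mpol f p = 0}"


section \<open>Monomial orders and standard indicator functions\<close>

definition graded_monomial_order :: "('x::finite mon \<Rightarrow> 'x mon \<Rightarrow> bool) \<Rightarrow> bool" where
  "graded_monomial_order prec \<longleftrightarrow>
     transp prec \<and> irreflp prec \<and> totalp prec \<and>
     (\<forall>m. m \<noteq> 0 \<longrightarrow> prec 0 m) \<and>
     (\<forall>a b c. prec a b \<longrightarrow> prec (a + c) (b + c)) \<and>
     (\<forall>a b. mdeg a < mdeg b \<longrightarrow> prec a b)"

text \<open>Only meaningful for nonzero polynomials.\<close>

definition lead_mon :: "('x mon \<Rightarrow> 'x mon \<Rightarrow> bool) \<Rightarrow> ('x, 'k::zero) mpol \<Rightarrow> 'x mon" where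
  "lead_mon prec f = (THE m. m \<in> Poly_Mapping.keys f \<and> (\<forall>n\<in>Poly_Mapping.keys f. n \<noteq> m \<longrightarrow> prec n m))"

definition lc :: "('x mon \<Rightarrow> 'x mon \<Rightarrow> bool) \<Rightarrow> ('x, 'k::zero) mpol \<Rightarrow> 'k" where
  "lc prec f = Poly_Mapping.lookup f (lead_mon prec f)"

definition initial_ideal ::
    "('x mon \<Rightarrow> 'x mon \<Rightarrow> bool) \<Rightarrow> ('x, 'k::field) mpol set \<Rightarrow> ('x, 'k) mpol set" where
  "initial_ideal prec I = ideal_gen {Poly_Mapping.single (lead_mon prec f) 1 | f. f \<in> I \<and> f \<noteq> 0}"

definition std_monomials ::
    "('x mon \<Rightarrow> 'x mon \<Rightarrow> bool) \<Rightarrow> ('x, 'k::field) mpol set \<Rightarrow> 'x mon set" where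
  "std_monomials prec I = {m. (Poly_Mapping.single m 1 :: ('x, 'k) mpol) \<notin> initial_ideal prec I}"

definition std_span ::
    "('x mon \<Rightarrow> 'x mon \<Rightarrow> bool) \<Rightarrow> ('x, 'k::field) mpol set \<Rightarrow> ('x, 'k) mpol set" where
  "std_span prec I = linear_span ((\<lambda>m. Poly_Mapping.single m 1) ` std_monomials prec I)"

text \<open>The standard indicator function of the \<open>i\<close>-th point of a finite family \<open>P\<close> of distinct points.\<close>

definition std_indicator ::
    "('x::finite mon \<Rightarrow> 'x mon \<Rightarrow> bool) \<Rightarrow> ('m \<Rightarrow> 'x \<Rightarrow> 'k::field) \<Rightarrow> 'm \<Rightarrow> ('x, 'k) mpol" where
  "std_indicator prec P i =
     (THE f. f \<in> std_span prec (vanishing_ideal (range P)) \<and>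
        (\<forall>j. eval_mpol f (P j) = (if j = i then 1 else 0)))"


section \<open>Affine Hilbert function\<close>

definition polys_le :: "nat \<Rightarrow> ('x::finite, 'k::zero) mpol set" where
  "polys_le d = {f. \<forall>m\<in>Poly_Mapping.keys f. mdeg m \<le> d}"

text \<open>\<open>B\<close> maps injectively onto a basis of the quotient space \<open>V / W\<close>: every vector of \<open>V\<close> is
  congruent modulo \<open>W\<close> to exactly one linear combination of \<open>B\<close>.\<close>

definition quotient_basis ::
    "('k::field \<Rightarrow> 'v::ab_group_add \<Rightarrow> 'v) \<Rightarrow> 'v set \<Rightarrow> 'v set \<Rightarrow> 'v set \<Rightarrow> bool" where
  "quotient_basis scale V W B \<longleftrightarrow>
     finite B \<and> B \<subseteq> V \<and>
     (\<forall>v\<in>V. \<exists>!c. c \<in> B \<rightarrow>\<^sub>E UNIV \<and> v - (\<Sum>b\<in>B. scale (c b) b) \<in> W)"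

definition quotient_dim ::
    "('k::field \<Rightarrow> 'v::ab_group_add \<Rightarrow> 'v) \<Rightarrow> 'v set \<Rightarrow> 'v set \<Rightarrow> nat" where
  "quotient_dim scale V W = (THE n. \<exists>B. quotient_basis scale V W B \<and> card B = n)"

definition affine_hilbert :: "('x::finite, 'k::field) mpol set \<Rightarrow> nat \<Rightarrow> nat" where
  "affine_hilbert I d = quotient_dim pscale (polys_le d) (I \<inter> polys_le d)"

definition regularity_index :: "('x::finite \<Rightarrow> 'k::field) set \<Rightarrow> nat" where
  "regularity_index X =
     (LEAST l. \<forall>d\<ge>l. affine_hilbert (vanishing_ideal X) d = card X)"


section \<open>Evaluation codes\<close>

definition eval_code :: "('m \<Rightarrow> 'x::finite \<Rightarrow> 'k::field) \<Rightarrow> nat \<Rightarrow> ('m \<Rightarrow> 'k) set" where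
  "eval_code P d = {\<lambda>i. eval_mpol f (P i) | f. f \<in> polys_le d}"

definition code_mult :: "('m \<Rightarrow> 'k::field) \<Rightarrow> ('m \<Rightarrow> 'k) set \<Rightarrow> ('m \<Rightarrow> 'k) set" where
  "code_mult \<alpha> C = {\<lambda>i. \<alpha> i * c i | c. c \<in> C}"

definition dual_code :: "('m::finite \<Rightarrow> 'k::field) set \<Rightarrow> ('m \<Rightarrow> 'k) set" where
  "dual_code C = {v. \<forall>c\<in>C. (\<Sum>i\<in>UNIV. v i * c i) = 0}"

definition self_dual :: "('m::finite \<Rightarrow> 'k::field) set \<Rightarrow> bool" where
  "self_dual C \<longleftrightarrow> C = dual_code C"


section \<open>Homogenization\<close>

text \<open>The homogenizing variable is \<open>None\<close>; the old variable \<open>x\<close> becomes \<open>Some x\<close>.\<close>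

definition homog_mon :: "nat \<Rightarrow> 'x::finite mon \<Rightarrow> 'x option mon" where
  "homog_mon e m = (\<Sum>x\<in>UNIV. Poly_Mapping.single (Some x) (Poly_Mapping.lookup m x)) + Poly_Mapping.single None (e - mdeg m)"

definition homogenization :: "('x::finite, 'k::field) mpol \<Rightarrow> ('x option, 'k) mpol" where
  "homogenization f = (\<Sum>m\<in>Poly_Mapping.keys f. Poly_Mapping.single (homog_mon (tdeg f) m) (Poly_Mapping.lookup f m))"

definition homog_ideal :: "('x::finite, 'k::field) mpol set \<Rightarrow> ('x option, 'k) mpol set" where
  "homog_ideal I = ideal_gen (homogenization ` I)"


section \<open>Cohen--Macaulay and Gorenstein graded quotients\<close>

definition homogeneous :: "('x::finite, 'k::zero) mpol \<Rightarrow> bool" where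
  "homogeneous f \<longleftrightarrow> (\<exists>n. \<forall>m\<in>Poly_Mapping.keys f. mdeg m = n)"

definition irrelevant_ideal :: "('x::finite, 'k::field) mpol set" where
  "irrelevant_ideal = ideal_gen (range var)"

text \<open>\<open>hs\<close> represents a homogeneous regular sequence, contained in the irrelevant ideal, on the
  quotient of the polynomial ring by \<open>J\<close>.\<close>

definition regular_seq :: "('x::finite, 'k::field) mpol set \<Rightarrow> ('x, 'k) mpol list \<Rightarrow> bool" where
  "regular_seq J hs \<longleftrightarrow>
     (\<forall>h\<in>set hs. homogeneous h \<and> h \<in> irrelevant_ideal) \<and>
     (\<forall>i<length hs. \<forall>g. hs ! i * g \<in> ideal_gen (J \<union> set (take i hs)) \<longrightarrow>
        g \<in> ideal_gen (J \<union> set (take i hs))) \<and>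
     ideal_gen (J \<union> set hs) \<noteq> UNIV"

definition quot_depth :: "('x::finite, 'k::field) mpol set \<Rightarrow> enat" where
  "quot_depth J = Sup {enat (length hs) | hs. regular_seq J hs}"

definition prime_ideal :: "'r::comm_ring_1 set \<Rightarrow> bool" where
  "prime_ideal Q \<longleftrightarrow>
     is_ideal Q \<and> Q \<noteq> UNIV \<and> (\<forall>a b. a * b \<in> Q \<longrightarrow> a \<in> Q \<or> b \<in> Q)"

text \<open>The Krull dimension of the quotient by \<open>J\<close>, via chains of primes containing \<open>J\<close>.\<close>

definition quot_krull_dim :: "'r::comm_ring_1 set \<Rightarrow> enat" where
  "quot_krull_dim J =
     Sup {enat n | n Q. (\<forall>i\<le>n. prime_ideal (Q i) \<and> J \<subseteq> Q i) \<and> (\<forall>i<n. Q i \<subset> Q (Suc i))}"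

definition cohen_macaulay_quot :: "('x::finite, 'k::field) mpol set \<Rightarrow> bool" where
  "cohen_macaulay_quot J \<longleftrightarrow> quot_depth J = quot_krull_dim J"

text \<open>A minimal graded free resolution
  \[ 0 \to F_p \to \dots \to F_1 \to F_0 = R \to R/J \to 0 \]
  of the quotient of the polynomial ring \<open>R\<close> by a homogeneous ideal \<open>J\<close>. The module \<open>F_i\<close> is the
  direct sum of the \<open>R(- d i j)\<close> for \<open>j < \<beta> i\<close>, and is zero for \<open>i > p\<close>; the matrix \<open>\<phi> i\<close> describes
  the map from \<open>F_(i+1)\<close> to \<open>F_i\<close>. The fourth condition says that the maps preserve degrees. The
  augmentation \<open>R \<rightarrow> R/J\<close> has kernel \<open>J\<close>, whence the condition on the image of \<open>\<phi> 0\<close>. Minimality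
  means that all matrix entries lie in the irrelevant ideal.\<close>

definition min_graded_free_resolution ::
    "('x::finite, 'k::field) mpol set \<Rightarrow> nat \<Rightarrow> (nat \<Rightarrow> nat) \<Rightarrow> (nat \<Rightarrow> nat \<Rightarrow> nat) \<Rightarrow>
     (nat \<Rightarrow> ('x, 'k) mpol mat) \<Rightarrow> bool" where
  "min_graded_free_resolution J p \<beta> d \<phi> \<longleftrightarrow>
     (\<beta> 0 = 1 \<and> d 0 0 = 0) \<and>
     (\<beta> p \<noteq> 0 \<and> (\<forall>i>p. \<beta> i = 0)) \<and>
     (\<forall>i. \<phi> i \<in> carrier_mat (\<beta> i) (\<beta> (Suc i))) \<and>
     (\<forall>i. \<forall>k<\<beta> i. \<forall>j<\<beta> (Suc i). \<forall>m\<in>Poly_Mapping.keys (\<phi> i $$ (k, j)). mdeg m + d i k = d (Suc i) j) \<and>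
     (\<forall>i. \<forall>k<\<beta> i. \<forall>j<\<beta> (Suc i). \<phi> i $$ (k, j) \<in> irrelevant_ideal) \<and>
     {\<phi> 0 *\<^sub>v v | v. v \<in> carrier_vec (\<beta> 1)} = {w \<in> carrier_vec 1. w $ 0 \<in> J} \<and>
     (\<forall>i. {\<phi> (Suc i) *\<^sub>v v | v. v \<in> carrier_vec (\<beta> (i + 2))} = mat_kernel (\<phi> i))"

definition gorenstein_quot :: "('x::finite, 'k::field) mpol set \<Rightarrow> bool" where
  "gorenstein_quot J \<longleftrightarrow>
     cohen_macaulay_quot J \<and>
     (\<exists>p \<beta> d \<phi>. min_graded_free_resolution J p \<beta> d \<phi> \<and> \<beta> p = 1)"

definition gorenstein :: "('x::finite, 'k::field) mpol set \<Rightarrow> bool" where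
  "gorenstein I \<longleftrightarrow> gorenstein_quot (homog_ideal I)"

end

theory Submission
  imports Defs "HOL-Library.Function_Algebras" "HOL-Library.Cardinality"
begin

text \<open>Filter the functions on the point set by degree: a function has degree at most \<open>e\<close> if it is the value vector
of a polynomial of degree at most \<open>e\<close>. The associated graded ring is \<open>A = S[u]/(I\<^sup>h, u)\<close>, and it ends in
degree \<open>r\<^sub>0\<close>, because every function has degree at most \<open>r\<^sub>0\<close>. A function of exact degree \<open>e\<close> whose
products with all coordinates still have degree at most \<open>e\<close> represents a socle element of \<open>A\<close>. The Gorenstein
hypothesis enters only through the fact that the socle of \<open>A\<close> is a line (\<open>gorenstein_socle_unique\<close>): all
functions with this property have the same degree, and they are proportional modulo functions of smaller degree.

The self-duality follows from this. The indicator function \<open>\<delta>\<close> of a point satisfies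
\<open>x\<^sub>j \<delta> = P\<^sub>i\<^sub>j \<delta>\<close>, so it is of socle type. Hence all indicator functions have degree \<open>r\<^sub>0\<close> and are
proportional modulo smaller degree, and the functions of degree less than \<open>r\<^sub>0\<close> form a hyperplane
\<open>\<Sum> \<lambda>\<^sub>i v\<^sub>i = 0\<close>. Passing to normal forms shows that \<open>\<lambda>\<^sub>i\<close> is, up to a common factor, the leading
coefficient of \<open>f\<^sub>i\<close>, which is \<open>\<alpha>\<^sub>i\<^sup>2\<close> (\<open>indicator_functional\<close>). Let \<open>r\<^sub>0 = 2 k + 1\<close>. A product of two
functions of degree at most \<open>k\<close> has degree less than \<open>r\<^sub>0\<close>, so the code is contained in its dual. Conversely
let \<open>w\<close> have exact degree \<open>e > k\<close>. Multiplying \<open>w\<close> by suitable coordinates raises the degree by one each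
time until a function of socle type is reached, which happens only in degree \<open>r\<^sub>0\<close> (\<open>multiple_outside\<close>). The
product of the \<open>r\<^sub>0 - e \<le> k\<close> coordinates is a polynomial \<open>g\<close> such that \<open>g w\<close> lies outside the
hyperplane, so \<open>\<alpha> w\<close> is not orthogonal to \<open>\<alpha> g\<close>.

To see that the socle is a line, tensor the Koszul complex on the \<open>s + 1\<close> variables of \<open>S[u]\<close> with the minimal
free resolution of \<open>S[u]/I\<^sup>h\<close>. Since \<open>u\<close> is a nonzerodivisor modulo \<open>I\<^sup>h\<close>, chasing a generator of the last
free module through this double complex bounds the length of the resolution by \<open>s\<close> (\<open>length_less_card\<close>), so
that the module in position \<open>s\<close> has rank at most 1. A function of socle type yields a cycle in Koszul degree \<open>s\<close>
with coefficients in \<open>S[u]/I\<^sup>h\<close>. The chase in the opposite direction attaches to it an element of the free module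
in position \<open>s\<close>, and when this element has zero constant term the cycle is a boundary. Two cycles therefore have
a nontrivial combination which is a boundary (\<open>penultimate_cycles_dependent\<close>), and for the underlying functions
this means that the combination drops in degree. In characteristic two the Koszul differential has no signs, so
that Koszul chains can be indexed by plain sets of variables.\<close>

section \<open>Polynomials and their values\<close>

lemma poly_sum_monomials:
  fixes f :: "('x, 'k::field) mpol"
  shows "f = (\<Sum>m\<in>Poly_Mapping.keys f. Poly_Mapping.single m (Poly_Mapping.lookup f m))"
proof (rule poly_mapping_eqI)
  fix k
  show "Poly_Mapping.lookup f k
      = Poly_Mapping.lookup (\<Sum>m\<in>Poly_Mapping.keys f. Poly_Mapping.single m (Poly_Mapping.lookup f m)) k"
    by (simp add: lookup_sum lookup_single when_def in_keys_iff)
qed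

lemma lookup_single_mult_plus [simp]:
  fixes f :: "('x, 'k::field) mpol"
  shows "Poly_Mapping.lookup (Poly_Mapping.single a c * f) (a + m) = c * Poly_Mapping.lookup f m"
  by (simp add: lookup_mult lookup_single when_mult)

lemma lookup_single_mult_other:
  fixes f :: "('x, 'k::field) mpol"
  assumes "\<And>m. k \<noteq> a + m"
  shows "Poly_Mapping.lookup (Poly_Mapping.single a c * f) k = 0"
  using assms by (simp add: lookup_mult lookup_single when_mult)

lemma lookup_const_mult [simp]:
  fixes f :: "('x, 'k::field) mpol"
  shows "Poly_Mapping.lookup (Poly_Mapping.single 0 c * f) m = c * Poly_Mapping.lookup f m"
  using lookup_single_mult_plus[of 0 c f m] by simp

lemma keys_single_mult:
  fixes f :: "('x, 'k::field) mpol"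
  assumes "c \<noteq> 0"
  shows "Poly_Mapping.keys (Poly_Mapping.single a c * f) = (+) a ` Poly_Mapping.keys f"
proof (rule Set.set_eqI)
  fix k
  show "k \<in> Poly_Mapping.keys (Poly_Mapping.single a c * f) \<longleftrightarrow> k \<in> (+) a ` Poly_Mapping.keys f"
  proof (cases "\<exists>m. k = a + m")
    case True
    then show ?thesis using assms by (auto simp: in_keys_iff)
  next
    case False
    then show ?thesis using lookup_single_mult_other[of k a c f] by (auto simp: in_keys_iff)
  qed
qed

lemma monomial_split:
  fixes m :: "'x mon"
  assumes "Poly_Mapping.lookup m x \<noteq> 0"
  shows "m = Poly_Mapping.single x 1 + (m - Poly_Mapping.single x 1)"
  by (rule poly_mapping_eqI) (use assms in \<open>auto simp: lookup_add lookup_minus lookup_single when_def\<close>)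

lemma lookup_var_mult:
  fixes f :: "('x, 'k::field) mpol"
  shows "Poly_Mapping.lookup (var x * f) m =
    (if Poly_Mapping.lookup m x = 0 then 0 else Poly_Mapping.lookup f (m - Poly_Mapping.single x 1))"
proof (cases "Poly_Mapping.lookup m x = 0")
  case True
  then have "m \<noteq> Poly_Mapping.single x 1 + n" for n
    by (auto simp: lookup_add)
  then show ?thesis using True unfolding var_def by (simp add: lookup_single_mult_other)
next
  case False
  have "Poly_Mapping.lookup (var x * f) (Poly_Mapping.single x 1 + (m - Poly_Mapping.single x 1))
      = Poly_Mapping.lookup f (m - Poly_Mapping.single x 1)"
    unfolding var_def by (simp only: lookup_single_mult_plus mult_1)
  then show ?thesis using False monomial_split[OF False] by simp
qed

lemma mdeg_add: "mdeg (a + b) = mdeg a + mdeg b"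
  by (simp add: mdeg_def lookup_add sum.distrib)

lemma mdeg_single [simp]: "mdeg (Poly_Mapping.single x k) = k"
  by (simp add: mdeg_def lookup_single when_def)

lemma mdeg_0 [simp]: "mdeg 0 = 0"
  by (simp add: mdeg_def)

lemma mdeg_diff_single:
  assumes "Poly_Mapping.lookup m x \<noteq> 0"
  shows "mdeg m = Suc (mdeg (m - Poly_Mapping.single x 1))"
  using arg_cong[OF monomial_split[OF assms], of mdeg] by (simp add: mdeg_add)

lemma finite_mdeg_le: "finite {m :: 'x::finite mon. mdeg m \<le> d}"
proof -
  have "Poly_Mapping.lookup m x \<le> mdeg m" for m :: "'x mon" and x
    unfolding mdeg_def by (rule member_le_sum) auto
  then have "Poly_Mapping.lookup ` {m :: 'x mon. mdeg m \<le> d} \<subseteq> UNIV \<rightarrow> {..d}"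
    by (fastforce intro: le_trans)
  moreover have "finite (UNIV \<rightarrow> {..d} :: ('x \<Rightarrow> nat) set)"
    using finite_PiE[of "UNIV :: 'x set" "\<lambda>_. {..d}"] by (simp add: PiE_def)
  ultimately have "finite (Poly_Mapping.lookup ` {m :: 'x mon. mdeg m \<le> d})"
    by (rule finite_subset)
  then show ?thesis
    by (rule finite_imageD) (auto intro: inj_onI poly_mapping_eqI)
qed

text \<open>Multiplicativity of evaluation and compatibility with ideals are linear statements once multiplication by a
variable is understood; this induction principle reduces them to that case.\<close>

lemma mpol_induct [case_names const add var]:
  fixes f :: "('x::finite, 'k::field) mpol"
  assumes const: "\<And>c. Q (Poly_Mapping.single 0 c)"
    and add: "\<And>f g. Q f \<Longrightarrow> Q g \<Longrightarrow> Q (f + g)"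
    and var: "\<And>x f. Q f \<Longrightarrow> Q (var x * f)"
  shows "Q f"
proof -
  have mon: "Q (Poly_Mapping.single m c)" for m c
  proof (induction "mdeg m" arbitrary: m)
    case 0
    then have "m = 0"
      by (intro poly_mapping_eqI) (simp add: mdeg_def)
    then show ?case using const by simp
  next
    case (Suc n)
    have "\<exists>x. Poly_Mapping.lookup m x \<noteq> 0"
    proof (rule ccontr)
      assume "\<nexists>x. Poly_Mapping.lookup m x \<noteq> 0"
      then have "mdeg m = 0" by (simp add: mdeg_def)
      with Suc show False by simp
    qed
    then obtain x where x: "Poly_Mapping.lookup m x \<noteq> 0" ..
    let ?m = "m - Poly_Mapping.single x 1"
    have "Q (Poly_Mapping.single ?m c)"
      using Suc mdeg_diff_single[OF x] by simp
    then have "Q (var x * Poly_Mapping.single ?m c)" by (rule var)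
    then show ?case
      using monomial_split[OF x] by (simp add: var_def mult_single)
  qed
  have "Q (\<Sum>m\<in>A. Poly_Mapping.single m (Poly_Mapping.lookup f m))" if "finite A" for A
    using that
  proof induction
    case empty
    then show ?case using const[of 0] by simp
  next
    case (insert m A)
    then show ?case by (simp add: add mon)
  qed
  then show ?thesis using poly_sum_monomials[of f] finite_keys by metis
qed

lemma eval_mpol_superset:
  assumes "finite A" "Poly_Mapping.keys f \<subseteq> A"
  shows "eval_mpol f p = (\<Sum>m\<in>A. Poly_Mapping.lookup f m * (\<Prod>x\<in>UNIV. p x ^ Poly_Mapping.lookup m x))"
  unfolding eval_mpol_def using assms
  by (intro sum.mono_neutral_left) (auto simp: in_keys_iff)

lemma eval_add [simp]: "eval_mpol (f + g) p = eval_mpol f p + eval_mpol g p"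
proof -
  let ?A = "Poly_Mapping.keys f \<union> Poly_Mapping.keys g"
  have "Poly_Mapping.keys (f + g) \<subseteq> ?A" by (rule keys_add)
  then show ?thesis
    by (simp add: eval_mpol_superset[of ?A] lookup_add algebra_simps sum.distrib)
qed

lemma eval_single:
  fixes c :: "'k::field"
  shows "eval_mpol (Poly_Mapping.single m c) p = c * (\<Prod>x\<in>UNIV. p x ^ Poly_Mapping.lookup m x)"
  by (cases "c = 0") (simp_all add: eval_mpol_def)

lemma eval_0 [simp]: "eval_mpol 0 p = 0"
  by (simp add: eval_mpol_def)

lemma eval_const [simp]: "eval_mpol (Poly_Mapping.single 0 (c :: 'k::field)) p = c"
  by (simp add: eval_single)

lemma eval_const_mult [simp]:
  fixes c :: "'k::field"
  shows "eval_mpol (Poly_Mapping.single 0 c * f) p = c * eval_mpol f p"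
  by (cases "c = 0") (simp_all add: eval_mpol_def keys_single_mult sum_distrib_left mult.assoc)

lemma eval_var_mult [simp]:
  fixes f :: "('x::finite, 'k::field) mpol"
  shows "eval_mpol (var x * f) p = p x * eval_mpol f p"
proof -
  have pow: "(\<Prod>y\<in>UNIV. p y ^ Poly_Mapping.lookup (Poly_Mapping.single x 1 + m) y)
      = p x * (\<Prod>y\<in>UNIV. p y ^ Poly_Mapping.lookup m y)" for m
  proof -
    have "(\<Prod>y\<in>UNIV. p y ^ Poly_Mapping.lookup (Poly_Mapping.single x (1::nat)) y) = p x"
      using prod.delta[of "UNIV :: 'x set" x p]
      by (simp add: lookup_single when_def if_distrib[where f = "\<lambda>k. _ ^ k"] eq_commute cong: if_cong)
    then show ?thesis by (simp add: lookup_add power_add prod.distrib)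
  qed
  have "eval_mpol (var x * f) p = (\<Sum>m\<in>Poly_Mapping.keys f. Poly_Mapping.lookup f m * (p x * (\<Prod>y\<in>UNIV. p y ^ Poly_Mapping.lookup m y)))"
    unfolding eval_mpol_def var_def keys_single_mult[OF one_neq_zero]
    by (subst sum.reindex) (auto simp: pow[simplified] inj_on_def)
  then show ?thesis by (simp add: eval_mpol_def sum_distrib_left algebra_simps)
qed

lemma eval_mult [simp]:
  fixes f g :: "('x::finite, 'k::field) mpol"
  shows "eval_mpol (f * g) p = eval_mpol f p * eval_mpol g p"
proof (induction f rule: mpol_induct)
  case (add f h)
  then show ?case by (simp add: algebra_simps)
next
  case (var x f)
  then show ?case by (simp add: mult.assoc)
qed simp

lemma eval_diff [simp]:
  fixes f g :: "('x::finite, 'k::field) mpol"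
  shows "eval_mpol (f - g) p = eval_mpol f p - eval_mpol g p"
  using eval_add[of "f - g" g p] by simp

lemma eval_sum [simp]:
  "eval_mpol (\<Sum>a\<in>A. f a) p = (\<Sum>a\<in>A. eval_mpol (f a) p)"
  by (induction A rule: infinite_finite_induct) auto

lemma eval_one [simp]: "eval_mpol (1 :: ('x::finite, 'k::field) mpol) p = 1"
  by (metis eval_const single_one)

lemma eval_var [simp]: "eval_mpol (var x :: ('x::finite, 'k::field) mpol) p = p x"
  using eval_var_mult[of x "Poly_Mapping.single 0 1 :: ('x, 'k) mpol" p] by simp

lemma eval_uminus [simp]: "eval_mpol (- f :: ('x::finite, 'k::field) mpol) p = - eval_mpol f p"
  using eval_diff[of 0 f p] by simp

text \<open>Strict degree bounds make the bound 0 meaningful: it describes only the zero polynomial, so the filtration by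
degree starts with the zero space.\<close>

definition polys_lt :: "nat \<Rightarrow> ('x::finite, 'k::zero) mpol set" where
  "polys_lt e = {f. \<forall>m\<in>Poly_Mapping.keys f. mdeg m < e}"

lemma polys_le_eq: "polys_le d = polys_lt (Suc d)"
  by (auto simp: polys_le_def polys_lt_def less_Suc_eq_le)

lemma polys_lt_iff: "f \<in> polys_lt e \<longleftrightarrow> (\<forall>m. mdeg m \<ge> e \<longrightarrow> Poly_Mapping.lookup f m = 0)"
  unfolding polys_lt_def mem_Collect_eq in_keys_iff Ball_def by (meson not_less)

lemma polys_lt_mono: "f \<in> polys_lt d \<Longrightarrow> d \<le> e \<Longrightarrow> f \<in> polys_lt e"
  by (auto simp: polys_lt_iff)

lemma polys_lt_zero [simp]: "0 \<in> polys_lt e"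
  by (simp add: polys_lt_iff)

lemma polys_lt_add: "f \<in> polys_lt e \<Longrightarrow> g \<in> polys_lt e \<Longrightarrow> f + g \<in> polys_lt e"
  by (simp add: polys_lt_iff lookup_add)

lemma polys_lt_sum:
  "(\<And>a. a \<in> A \<Longrightarrow> f a \<in> polys_lt e) \<Longrightarrow> (\<Sum>a\<in>A. f a) \<in> polys_lt e"
  by (induction A rule: infinite_finite_induct) (auto intro: polys_lt_add)

lemma polys_lt_const_mult:
  fixes f :: "('x::finite, 'k::field) mpol"
  shows "f \<in> polys_lt e \<Longrightarrow> Poly_Mapping.single 0 c * f \<in> polys_lt e"
  by (simp add: polys_lt_iff)

lemma polys_lt_mult:
  fixes f g :: "('x::finite, 'k::field) mpol"
  assumes "f \<in> polys_lt (Suc d)" "g \<in> polys_lt e"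
  shows "f * g \<in> polys_lt (d + e)"
  unfolding polys_lt_def
proof safe
  fix m assume "m \<in> Poly_Mapping.keys (f * g)"
  then obtain a b where "a \<in> Poly_Mapping.keys f" "b \<in> Poly_Mapping.keys g" "m = a + b"
    using keys_mult[of f g] by auto
  then show "mdeg m < d + e"
    using assms by (auto simp: polys_lt_def mdeg_add less_Suc_eq_le intro: add_le_less_mono)
qed

lemma polys_lt_var_mult:
  fixes f :: "('x::finite, 'k::field) mpol"
  assumes "f \<in> polys_lt e"
  shows "var x * f \<in> polys_lt (Suc e)"
  unfolding polys_lt_iff lookup_var_mult
proof (intro allI impI)
  fix m :: "'x mon"
  assume m: "Suc e \<le> mdeg m"
  show "(if Poly_Mapping.lookup m x = 0 then 0
      else Poly_Mapping.lookup f (m - Poly_Mapping.single x 1)) = 0"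
    using assms m mdeg_diff_single[of m x] by (auto simp: polys_lt_iff)
qed

lemma polys_lt_exists: "\<exists>e. (f :: ('x::finite, 'k::field) mpol) \<in> polys_lt e"
proof
  show "f \<in> polys_lt (Suc (Max (mdeg ` Poly_Mapping.keys f)))"
    by (auto simp: polys_lt_def less_Suc_eq_le)
qed


section \<open>Homogenization and the vanishing ideal of the projective closure\<close>

lemmas ideal_gen_base = Modules.module.span_base[OF module_self]
  and ideal_gen_mult = Modules.module.span_scale[OF module_self]
  and ideal_gen_sum = Modules.module.span_sum[OF module_self]
  and ideal_gen_induct = Modules.module.span_induct_alt[OF module_self, consumes 1, case_names zero step]

lemma sum_option_UNIV:
  fixes g :: "'x::finite option \<Rightarrow> 'a::comm_monoid_add"
  shows "sum g UNIV = g None + (\<Sum>x\<in>UNIV. g (Some x))"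
  by (simp add: UNIV_option_conv sum.reindex)

definition dehom_mon :: "'x::finite option mon \<Rightarrow> 'x mon" where
  "dehom_mon M = (\<Sum>x\<in>UNIV. Poly_Mapping.single x (Poly_Mapping.lookup M (Some x)))"

lemma lookup_dehom_mon [simp]:
  "Poly_Mapping.lookup (dehom_mon M) x = Poly_Mapping.lookup M (Some x)"
  by (simp add: dehom_mon_def lookup_sum lookup_single when_def)

lemma lookup_homog_mon_Some [simp]:
  "Poly_Mapping.lookup (homog_mon e m) (Some x) = Poly_Mapping.lookup m x"
  by (simp add: homog_mon_def lookup_sum lookup_add lookup_single when_def)

lemma lookup_homog_mon_None [simp]:
  "Poly_Mapping.lookup (homog_mon e m) None = e - mdeg m"
  by (simp add: homog_mon_def lookup_sum lookup_add lookup_single)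

lemma mdeg_option: "mdeg M = Poly_Mapping.lookup M None + mdeg (dehom_mon M)"
  by (simp add: mdeg_def sum_option_UNIV)

lemma dehom_homog_mon [simp]: "dehom_mon (homog_mon e m) = m"
  by (rule poly_mapping_eqI) simp

lemma option_mon_eqI:
  assumes "Poly_Mapping.lookup M None = Poly_Mapping.lookup N None"
    and "\<And>x. Poly_Mapping.lookup M (Some x) = Poly_Mapping.lookup N (Some x)"
  shows "M = N"
proof (rule poly_mapping_eqI)
  show "Poly_Mapping.lookup M k = Poly_Mapping.lookup N k" for k
    using assms by (cases k) auto
qed

lemma homog_dehom_mon: "mdeg M = e \<Longrightarrow> homog_mon e (dehom_mon M) = M"
  by (rule option_mon_eqI) (auto simp: mdeg_option)

lemma mdeg_homog_mon: "mdeg m \<le> e \<Longrightarrow> mdeg (homog_mon e m) = e"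
  by (simp add: mdeg_option)

definition homogenize :: "nat \<Rightarrow> ('x::finite, 'k::field) mpol \<Rightarrow> ('x option, 'k) mpol" where
  "homogenize e f =
     (\<Sum>m\<in>Poly_Mapping.keys f. Poly_Mapping.single (homog_mon e m) (Poly_Mapping.lookup f m))"

text \<open>The homogeneous component of degree \<open>e\<close>, with the homogenizing variable set to 1.\<close>

definition dehom_part :: "nat \<Rightarrow> ('x::finite option, 'k::field) mpol \<Rightarrow> ('x, 'k) mpol" where
  "dehom_part e F =
     (\<Sum>M\<in>{M\<in>Poly_Mapping.keys F. mdeg M = e}. Poly_Mapping.single (dehom_mon M) (Poly_Mapping.lookup F M))"

lemma lookup_homogenize:
  assumes "f \<in> polys_lt (Suc e)"
  shows "Poly_Mapping.lookup (homogenize e f) M =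
    (if mdeg M = e then Poly_Mapping.lookup f (dehom_mon M) else 0)"
proof -
  have "homog_mon e m = M \<longleftrightarrow> mdeg M = e \<and> m = dehom_mon M" if "m \<in> Poly_Mapping.keys f" for m
    using that assms mdeg_homog_mon[of m e] homog_dehom_mon[of M e]
    by (auto simp: polys_lt_def less_Suc_eq_le)
  then have "Poly_Mapping.lookup (homogenize e f) M =
      (\<Sum>m\<in>Poly_Mapping.keys f. if mdeg M = e \<and> m = dehom_mon M then Poly_Mapping.lookup f m else 0)"
    unfolding homogenize_def lookup_sum lookup_single when_def by (intro sum.cong) auto
  then show ?thesis by (simp add: in_keys_iff)
qed

lemma lookup_dehom_part:
  "Poly_Mapping.lookup (dehom_part e F) m =
    (if mdeg m \<le> e then Poly_Mapping.lookup F (homog_mon e m) else 0)"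
proof -
  let ?A = "{M \<in> Poly_Mapping.keys F. mdeg M = e}"
  have "dehom_mon M = m \<longleftrightarrow> mdeg m \<le> e \<and> M = homog_mon e m" if "M \<in> ?A" for M
  proof
    assume "dehom_mon M = m"
    with that show "mdeg m \<le> e \<and> M = homog_mon e m"
      using homog_dehom_mon[of M e] mdeg_option[of M] by auto
  next
    assume "mdeg m \<le> e \<and> M = homog_mon e m"
    then show "dehom_mon M = m" by simp
  qed
  then have "Poly_Mapping.lookup (dehom_part e F) m =
      (\<Sum>M\<in>?A. if mdeg m \<le> e \<and> M = homog_mon e m then Poly_Mapping.lookup F M else 0)"
    unfolding dehom_part_def lookup_sum lookup_single when_def by (intro sum.cong) auto
  also have "\<dots> = (if mdeg m \<le> e then \<Sum>M\<in>?A. if M = homog_mon e m then Poly_Mapping.lookup F M else 0 else 0)"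
    by simp
  also have "\<dots> = (if mdeg m \<le> e then Poly_Mapping.lookup F (homog_mon e m) else 0)"
    by (simp add: in_keys_iff mdeg_homog_mon)
  finally show ?thesis .
qed

lemma homogenization_eq: "homogenization f = homogenize (tdeg f) f"
  by (simp add: homogenization_def homogenize_def)

lemma homogenize_add:
  assumes "f \<in> polys_lt (Suc e)" "g \<in> polys_lt (Suc e)"
  shows "homogenize e (f + g) = homogenize e f + homogenize e g"
  by (rule poly_mapping_eqI) (simp add: lookup_homogenize assms polys_lt_add lookup_add)

lemma dehom_mon_diff_Some:
  "dehom_mon (M - Poly_Mapping.single (Some x) 1) = dehom_mon M - Poly_Mapping.single x 1"
  by (rule poly_mapping_eqI) (simp add: lookup_minus lookup_single when_def)

lemma dehom_mon_diff_None:
  "dehom_mon (M - Poly_Mapping.single None 1) = dehom_mon M"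
  by (rule poly_mapping_eqI) (simp add: lookup_minus lookup_single when_def)

lemma homogenize_var_Some:
  assumes "f \<in> polys_lt (Suc e)"
  shows "homogenize (Suc e) (var x * f) = var (Some x) * homogenize e f"
proof (rule poly_mapping_eqI)
  fix M :: "'a option mon"
  show "Poly_Mapping.lookup (homogenize (Suc e) (var x * f)) M
      = Poly_Mapping.lookup (var (Some x) * homogenize e f) M"
    using mdeg_diff_single[of M "Some x"]
    by (auto simp: lookup_homogenize assms polys_lt_var_mult lookup_var_mult dehom_mon_diff_Some[simplified])
qed

lemma homogenize_var_None:
  assumes "f \<in> polys_lt (Suc e)"
  shows "homogenize (Suc e) f = var None * homogenize e f"
proof (rule poly_mapping_eqI)
  fix M :: "'a option mon"
  have "f \<in> polys_lt (Suc (Suc e))" using assms by (rule polys_lt_mono) simp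
  moreover have "Poly_Mapping.lookup f (dehom_mon M) = 0"
    if "mdeg M = Suc e" "Poly_Mapping.lookup M None = 0"
    using assms that by (simp add: polys_lt_iff mdeg_option)
  ultimately show "Poly_Mapping.lookup (homogenize (Suc e) f) M
      = Poly_Mapping.lookup (var None * homogenize e f) M"
    using mdeg_diff_single[of M None]
    by (auto simp: lookup_homogenize assms lookup_var_mult dehom_mon_diff_None[simplified])
qed

lemma dehom_part_add: "dehom_part e (F + G) = dehom_part e F + dehom_part e G"
  by (rule poly_mapping_eqI) (simp add: lookup_dehom_part lookup_add)

lemma dehom_part_zero [simp]: "dehom_part e 0 = 0"
  by (simp add: dehom_part_def)

lemma dehom_part_const_mult:
  "dehom_part e (Poly_Mapping.single 0 c * F) = Poly_Mapping.single 0 c * dehom_part e F"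
  by (rule poly_mapping_eqI) (simp add: lookup_dehom_part)

lemma dehom_part_polys_lt [simp]: "dehom_part e F \<in> polys_lt (Suc e)"
  by (simp add: polys_lt_iff lookup_dehom_part)

lemma homog_mon_diff_Some:
  assumes "Poly_Mapping.lookup m x \<noteq> 0"
  shows "homog_mon (Suc e) m - Poly_Mapping.single (Some x) 1 = homog_mon e (m - Poly_Mapping.single x 1)"
  using mdeg_diff_single[OF assms]
  by (intro option_mon_eqI) (auto simp: lookup_minus lookup_single when_def)

lemma homog_mon_diff_None:
  "homog_mon (Suc e) m - Poly_Mapping.single None 1 = homog_mon e m"
  by (intro option_mon_eqI) (auto simp: lookup_minus lookup_single)

lemma dehom_part_var_Some: "dehom_part (Suc e) (var (Some x) * F) = var x * dehom_part e F"
proof (rule poly_mapping_eqI)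
  fix m
  show "Poly_Mapping.lookup (dehom_part (Suc e) (var (Some x) * F)) m
      = Poly_Mapping.lookup (var x * dehom_part e F) m"
    using mdeg_diff_single[of m x] homog_mon_diff_Some[of m x e]
    by (auto simp: lookup_dehom_part lookup_var_mult)
qed

lemma dehom_part_var_None: "dehom_part (Suc e) (var None * F) = dehom_part e F"
proof (rule poly_mapping_eqI)
  fix m
  show "Poly_Mapping.lookup (dehom_part (Suc e) (var None * F)) m
      = Poly_Mapping.lookup (dehom_part e F) m"
    using homog_mon_diff_None[of e m]
    by (auto simp: lookup_dehom_part lookup_var_mult)
qed

lemma dehom_part_0_var: "dehom_part 0 (var y * F) = 0"
proof (rule poly_mapping_eqI)
  fix m
  have "Poly_Mapping.lookup (homog_mon 0 m) y = 0" if "mdeg m = 0"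
    using that by (cases y) (simp_all add: mdeg_def)
  then show "Poly_Mapping.lookup (dehom_part 0 (var y * F)) m = Poly_Mapping.lookup 0 m"
    by (simp add: lookup_dehom_part lookup_var_mult)
qed

lemma dehom_part_homogenize:
  assumes "f \<in> polys_lt (Suc e)"
  shows "dehom_part d (homogenize e f) = (if d = e then f else 0)"
  using assms
  by (intro poly_mapping_eqI) (auto simp: lookup_dehom_part lookup_homogenize mdeg_homog_mon polys_lt_iff)

lemma homogeneous_decomposition:
  assumes "F \<in> polys_lt N"
  shows "F = (\<Sum>e<N. homogenize e (dehom_part e F))"
proof (rule poly_mapping_eqI)
  fix M
  have "Poly_Mapping.lookup (homogenize e (dehom_part e F)) M
      = (if mdeg M = e then Poly_Mapping.lookup F M else 0)" for e
    by (auto simp: lookup_homogenize lookup_dehom_part homog_dehom_mon mdeg_option)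
  then show "Poly_Mapping.lookup F M
      = Poly_Mapping.lookup (\<Sum>e<N. homogenize e (dehom_part e F)) M"
    using assms by (simp add: lookup_sum polys_lt_iff)
qed

lemma tdeg_polys_lt: "f \<in> polys_lt (Suc (tdeg f))"
  by (auto simp: polys_lt_def tdeg_def less_Suc_eq_le)

lemma tdeg_le: "f \<in> polys_lt (Suc e) \<Longrightarrow> tdeg f \<le> e"
  by (auto simp: polys_lt_def tdeg_def less_Suc_eq_le)

text \<open>The generator of the homogenized ideal attached to \<open>f\<close> is the homogenization in degree \<open>tdeg f\<close>;
higher degrees are reached by multiplying with the homogenizing variable.\<close>

lemma homogenize_in_homog_ideal:
  assumes "f \<in> I" "f \<in> polys_lt (Suc e)"
  shows "homogenize e f \<in> homog_ideal I"
proof -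
  have "homogenize (tdeg f + k) f \<in> homog_ideal I" for k
  proof (induction k)
    case 0
    then show ?case
      using assms(1) by (auto simp: homog_ideal_def homogenization_eq[symmetric] intro: ideal_gen_base)
  next
    case (Suc k)
    moreover have "f \<in> polys_lt (Suc (tdeg f + k))"
      using tdeg_polys_lt by (rule polys_lt_mono) simp
    ultimately show ?case
      by (simp add: homogenize_var_None homog_ideal_def ideal_gen_mult)
  qed
  from this[of "e - tdeg f"] show ?thesis using tdeg_le[OF assms(2)] by simp
qed

lemma dehom_part_mult_vanishing:
  assumes "\<And>e. dehom_part e F \<in> vanishing_ideal X"
  shows "dehom_part e (G * F) \<in> vanishing_ideal X"
proof (induction G arbitrary: e rule: mpol_induct)
  case (const c)
  then show ?case using assms by (simp add: dehom_part_const_mult vanishing_ideal_def)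
next
  case (add f g)
  then show ?case by (simp add: distrib_right dehom_part_add vanishing_ideal_def)
next
  case (var y f)
  show ?case
  proof (cases e)
    case 0
    then show ?thesis by (simp add: mult.assoc dehom_part_0_var vanishing_ideal_def)
  next
    case (Suc d)
    then show ?thesis using var[of d]
      by (cases y) (simp_all add: mult.assoc dehom_part_var_None dehom_part_var_Some vanishing_ideal_def)
  qed
qed

text \<open>The homogenized ideal consists of the polynomials all of whose homogeneous components vanish on the points in
the affine chart. The condition defines an ideal because multiplication by a variable only shifts components; it
contains the generators, and conversely a polynomial is the sum of the homogenizations of its dehomogenized
components.\<close>

lemma homog_ideal_iff:
  "F \<in> homog_ideal (vanishing_ideal X) \<longleftrightarrow> (\<forall>e. dehom_part e F \<in> vanishing_ideal X)"
proof
  assume "F \<in> homog_ideal (vanishing_ideal X)"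
  then have "\<forall>e. dehom_part e F \<in> vanishing_ideal X"
    unfolding homog_ideal_def
  proof (induction rule: ideal_gen_induct)
    case zero
    then show ?case by (simp add: vanishing_ideal_def)
  next
    case (step c x y)
    have "dehom_part e x \<in> vanishing_ideal X" for e
      using step(1) by (auto simp: homogenization_eq dehom_part_homogenize tdeg_polys_lt vanishing_ideal_def)
    from dehom_part_mult_vanishing[OF this] step(2) show ?case
      by (simp add: dehom_part_add vanishing_ideal_def)
  qed
  then show "\<forall>e. dehom_part e F \<in> vanishing_ideal X" .
next
  assume *: "\<forall>e. dehom_part e F \<in> vanishing_ideal X"
  obtain N where "F \<in> polys_lt N" using polys_lt_exists by blast
  moreover have "(\<Sum>e<N. homogenize e (dehom_part e F)) \<in> homog_ideal (vanishing_ideal X)"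
    unfolding homog_ideal_def
    using * by (intro ideal_gen_sum homogenize_in_homog_ideal[unfolded homog_ideal_def]) auto
  ultimately show "F \<in> homog_ideal (vanishing_ideal X)"
    using homogeneous_decomposition by metis
qed

text \<open>Setting \<open>u = 1\<close> does not see a factor \<open>u\<close>, so \<open>u\<close> is a nonzerodivisor modulo the homogenized ideal.\<close>

lemma homog_var_regular:
  assumes "var None * F \<in> homog_ideal (vanishing_ideal X)"
  shows "F \<in> homog_ideal (vanishing_ideal X)"
  using assms dehom_part_var_None unfolding homog_ideal_iff by metis


section \<open>Double complexes with exact rows and columns\<close>

text \<open>Rows and columns are exact except at index 0. The differentials commute rather than anticommute, which is the
convenient sign convention for following zigzags without forming the total complex.\<close>

locale double_complex =
  fixes C :: "nat \<Rightarrow> nat \<Rightarrow> 'a::ab_group_add set"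
    and h v :: "nat \<Rightarrow> 'a \<Rightarrow> 'a"
  assumes diff_in: "x \<in> C i j \<Longrightarrow> y \<in> C i j \<Longrightarrow> x - y \<in> C i j"
    and h_in: "x \<in> C (Suc i) j \<Longrightarrow> h i x \<in> C i j"
    and v_in: "x \<in> C i (Suc j) \<Longrightarrow> v j x \<in> C i j"
    and h_diff: "h i (x - y) = h i x - h i y"
    and v_diff: "v j (x - y) = v j x - v j y"
    and h_v: "x \<in> C (Suc i) (Suc j) \<Longrightarrow> h i (v j x) = v j (h i x)"
    and h_h: "x \<in> C (Suc (Suc i)) j \<Longrightarrow> h i (h (Suc i) x) = 0"
    and v_v: "x \<in> C i (Suc (Suc j)) \<Longrightarrow> v j (v (Suc j) x) = 0"
    and h_exact: "x \<in> C (Suc i) j \<Longrightarrow> h i x = 0 \<Longrightarrow> x \<in> h (Suc i) ` C (Suc (Suc i)) j"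
    and v_exact: "x \<in> C i (Suc j) \<Longrightarrow> v j x = 0 \<Longrightarrow> x \<in> v (Suc j) ` C i (Suc (Suc j))"
begin

text \<open>A zigzag descends the antidiagonal \<open>C n 0, C (n - 1) 1, \<dots>, C 0 n\<close>; its two end points
represent classes in the homology of the complexes of column cokernels and of row cokernels, and passing from one
end to the other identifies these homologies.\<close>

definition zigzag :: "nat \<Rightarrow> (nat \<Rightarrow> 'a) \<Rightarrow> bool" where
  "zigzag n z \<longleftrightarrow>
     (\<forall>k\<le>n. z k \<in> C (n - k) k) \<and> (\<forall>k<n. h (n - Suc k) (z k) = v k (z (Suc k)))"

text \<open>Each step lifts the horizontal image of the current element along the vertical differential; the next
horizontal image is again a vertical cycle, hence a vertical boundary.\<close>

lemma zigzag_exists: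
  assumes start: "z0 \<in> C n 0"
    and cycle: "0 < n \<Longrightarrow> h (n - Suc 0) z0 \<in> v 0 ` C (n - Suc 0) (Suc 0)"
  shows "\<exists>z. zigzag n z \<and> z 0 = z0"
proof -
  define Q where "Q k x \<longleftrightarrow> (k \<le> n \<longrightarrow> x \<in> C (n - k) k) \<and> (k = 0 \<longrightarrow> x = z0) \<and>
      (k < n \<longrightarrow> h (n - Suc k) x \<in> v k ` C (n - Suc k) (Suc k))" for k x
  have "\<exists>x. Q 0 x"
    using assms by (auto simp: Q_def)
  moreover have "\<exists>y. Q (Suc k) y \<and> (k < n \<longrightarrow> h (n - Suc k) x = v k y)" if q: "Q k x" for k x
  proof (cases "k < n")
    case True
    then obtain y where y: "y \<in> C (n - Suc k) (Suc k)" "h (n - Suc k) x = v k y"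
      using q by (auto simp: Q_def)
    have "h (n - Suc (Suc k)) y \<in> v (Suc k) ` C (n - Suc (Suc k)) (Suc (Suc k))" if "Suc k < n"
    proof (rule v_exact)
      have eq: "n - Suc k = Suc (n - Suc (Suc k))" using \<open>Suc k < n\<close> by simp
      have x: "x \<in> C (Suc (Suc (n - Suc (Suc k)))) k"
        using q \<open>Suc k < n\<close> by (simp add: Q_def Suc_diff_Suc)
      show "h (n - Suc (Suc k)) y \<in> C (n - Suc (Suc k)) (Suc k)"
        using y(1) by (intro h_in) (simp add: eq)
      have "v k (h (n - Suc (Suc k)) y) = h (n - Suc (Suc k)) (v k y)"
        using y(1) by (intro h_v[symmetric]) (simp add: eq)
      also have "\<dots> = 0"
        using h_h[OF x] by (simp add: y(2)[symmetric] eq)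
      finally show "v k (h (n - Suc (Suc k)) y) = 0" .
    qed
    with y show ?thesis by (auto simp: Q_def)
  next
    case False
    then show ?thesis by (auto simp: Q_def)
  qed
  ultimately obtain z where z: "\<And>k. Q k (z k) \<and> (k < n \<longrightarrow> h (n - Suc k) (z k) = v k (z (Suc k)))"
    using dependent_nat_choice[of Q "\<lambda>k x y. k < n \<longrightarrow> h (n - Suc k) x = v k y"] by metis
  then have "zigzag n z" "z 0 = z0" by (auto simp: zigzag_def Q_def)
  then show ?thesis by blast
qed

text \<open>The identification is injective: if the last element of a zigzag is a sum of a horizontal and
a vertical boundary, then so is the element before it, by exactness of the rows, and so on up to the first.\<close>

lemma zigzag_boundary:
  assumes z: "zigzag n z"
    and last: "z n = h 0 w + v n u" "w \<in> C (Suc 0) n" "u \<in> C 0 (Suc n)"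
  shows "\<exists>w\<in>C (Suc n) 0. \<exists>u\<in>C n (Suc 0). z 0 = h n w + v 0 u"
proof -
  have "k \<le> n \<Longrightarrow> \<exists>w\<in>C (Suc k) (n - k). \<exists>u\<in>C k (Suc (n - k)). z (n - k) = h k w + v (n - k) u" for k
  proof (induction k)
    case 0
    then show ?case using last by auto
  next
    case (Suc k)
    define j where "j = n - Suc k"
    have j: "n - k = Suc j" "n - j = Suc k" "n - Suc j = k" "j < n" "j \<le> n"
      using Suc.prems by (auto simp: j_def)
    obtain w u where w: "w \<in> C (Suc k) (Suc j)" and u: "u \<in> C k (Suc (Suc j))"
      and eq: "z (Suc j) = h k w + v (Suc j) u"
      using Suc j by auto
    have zj: "z j \<in> C (Suc k) j" and hz: "h k (z j) = v j (z (Suc j))"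
      using z j unfolding zigzag_def by metis+
    have "h k (z j) - h k (v j w) = v j (z (Suc j) - h k w)"
      using w by (simp add: hz h_v v_diff)
    also have "\<dots> = 0" using v_v[OF u] by (simp add: eq)
    finally have "h k (z j - v j w) = 0" by (simp add: h_diff)
    moreover have "z j - v j w \<in> C (Suc k) j" using zj w by (intro diff_in v_in)
    ultimately obtain w' where "w' \<in> C (Suc (Suc k)) j" "z j - v j w = h (Suc k) w'"
      using h_exact by blast
    then have "w' \<in> C (Suc (Suc k)) j" "z j = h (Suc k) w' + v j w"
      by (auto simp: algebra_simps)
    then show ?case using w unfolding j_def[symmetric] by auto
  qed
  from this[of n] show ?thesis by simp
qed

end

text \<open>The symmetry turns each chase into the chase in the opposite direction.\<close>

lemma double_complex_transpose:
  assumes "double_complex C h v"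
  shows "double_complex (\<lambda>i j. C j i) v h"
proof -
  interpret double_complex C h v by fact
  show ?thesis
    by unfold_locales
      (fact diff_in v_in h_in v_diff h_diff h_v[symmetric] v_v h_h v_exact h_exact)+
qed


section \<open>Koszul complexes in characteristic two\<close>

text \<open>The Koszul differential for the family \<open>y\<close>, where \<open>c T\<close> is the coefficient of the exterior monomial indexed
by \<open>T\<close>. The usual signs are absent, so this squares to zero only in characteristic two.\<close>

definition koszul :: "('x::finite \<Rightarrow> 'r::comm_ring_1) \<Rightarrow> ('x set \<Rightarrow> 'r) \<Rightarrow> 'x set \<Rightarrow> 'r" where
  "koszul y c T = (\<Sum>x\<in>-T. y x * c (insert x T))"

lemma sum_off_diagonal_char2:
  fixes g :: "'x \<Rightarrow> 'x \<Rightarrow> 'r::comm_ring_1"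
  assumes "\<And>r :: 'r. r + r = 0" "finite A" "\<And>x z. g x z = g z x"
  shows "(\<Sum>x\<in>A. \<Sum>z\<in>A - {x}. g x z) = 0"
  using assms(2)
proof induction
  case (insert a A)
  have "(\<Sum>z\<in>insert a A - {x}. g x z) = g a x + (\<Sum>z\<in>A - {x}. g x z)" if "x \<in> A" for x
  proof -
    have "insert a A - {x} = insert a (A - {x})" using insert that by auto
    then show ?thesis using insert assms(3)[of a x] by simp
  qed
  moreover have "insert a A - {a} = A" using insert by auto
  ultimately show ?case
    using insert assms(1) by (simp add: sum.distrib)
qed simp

text \<open>Every pair \<open>x \<noteq> z\<close> of added indices occurs in both orders, and the two contributions cancel.\<close>

lemma koszul_koszul:
  fixes y :: "'x::finite \<Rightarrow> 'r::comm_ring_1"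
  assumes "\<And>r :: 'r. r + r = 0"
  shows "koszul y (koszul y c) T = 0"
proof -
  have "koszul y (koszul y c) T
      = (\<Sum>x\<in>-T. \<Sum>z\<in>-T - {x}. y x * y z * c (insert x (insert z T)))"
    unfolding koszul_def sum_distrib_left
    by (intro sum.cong) (auto simp: mult.assoc insert_commute)
  also have "\<dots> = 0"
    by (rule sum_off_diagonal_char2) (auto simp: assms mult.commute insert_commute)
  finally show ?thesis .
qed

lemma koszul_diff: "koszul y (\<lambda>T. c T - c' T) T = koszul y c T - koszul y c' T"
  by (simp add: koszul_def right_diff_distrib sum_subtractf)

lemma koszul_scale: "koszul y (\<lambda>T. r * c T) T = r * koszul y c T"
  by (simp add: koszul_def sum_distrib_left mult_ac)

text \<open>Singling out one index \<open>x\<close> exhibits the Koszul complex as the mapping cone of multiplication by \<open>y x\<close> on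
the Koszul complex of the other indices.\<close>

lemma koszul_split:
  assumes "x \<notin> T"
  shows "koszul y c T = y x * c (insert x T) + koszul y (\<lambda>T. if x \<in> T then 0 else c T) T"
    and "koszul y c (insert x T) = koszul y (\<lambda>T. if x \<in> T then 0 else c (insert x T)) T"
proof -
  have T: "- T = insert x (- insert x T)" using assms by auto
  have rest: "(\<Sum>z\<in>-T. y z * (if x \<in> insert z T then 0 else d z)) = (\<Sum>z\<in>-insert x T. y z * d z)" for d
  proof -
    have "(\<Sum>z\<in>-T. y z * (if x \<in> insert z T then 0 else d z))
        = (\<Sum>z\<in>-insert x T. y z * (if x \<in> insert z T then 0 else d z))"
      by (subst T, subst sum.insert) simp_all
    also have "\<dots> = (\<Sum>z\<in>-insert x T. y z * d z)"
      by (rule sum.cong) (use assms in \<open>auto split: if_splits\<close>)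
    finally show ?thesis .
  qed
  have "koszul y c T = y x * c (insert x T) + (\<Sum>z\<in>-insert x T. y z * c (insert z T))"
    unfolding koszul_def by (subst T) simp
  then show "koszul y c T = y x * c (insert x T) + koszul y (\<lambda>T. if x \<in> T then 0 else c T) T"
    using rest[of "\<lambda>z. c (insert z T)"] by (simp add: koszul_def)
  show "koszul y c (insert x T) = koszul y (\<lambda>T. if x \<in> T then 0 else c (insert x T)) T"
    using rest[of "\<lambda>z. c (insert x (insert z T))"] by (simp add: koszul_def insert_commute)
qed

text \<open>The Koszul complex of a family that is regular in every order is exact in positive degrees. The induction adds
one index at a time; regularity is used only in the lowest degree, where multiplication by \<open>y x\<close> has to be
injective modulo the ideal generated by the other members of the family.\<close>

lemma koszul_exact:
  fixes y :: "'x::finite \<Rightarrow> 'r::comm_ring_1"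
  assumes char2: "\<And>r :: 'r. r + r = 0"
    and regular: "\<And>V x b r. x \<notin> V \<Longrightarrow> y x * b = (\<Sum>u\<in>V. y u * r u) \<Longrightarrow> \<exists>r. b = (\<Sum>u\<in>V. y u * r u)"
    and support: "\<And>T. c T \<noteq> 0 \<Longrightarrow> T \<subseteq> V \<and> card T = Suc i"
    and cycle: "\<And>T. koszul y c T = 0"
  shows "\<exists>w. (\<forall>T. w T \<noteq> 0 \<longrightarrow> T \<subseteq> V \<and> card T = Suc (Suc i)) \<and> koszul y w = c"
proof -
  have "finite V" by simp
  then show ?thesis using support cycle
  proof (induction V arbitrary: i c)
    case empty
    then have "c = (\<lambda>T. 0)" by fastforce
    then show ?case by (intro exI[of _ "\<lambda>T. 0"]) (simp add: koszul_def fun_eq_iff)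
  next
    case (insert x V)
    define a where "a T = (if x \<in> T then 0 else c T)" for T
    define b where "b T = (if x \<in> T then 0 else c (insert x T))" for T
    have a_supp: "T \<subseteq> V \<and> card T = Suc i" if "a T \<noteq> 0" for T
      using that insert.prems(1)[of T] by (auto simp: a_def split: if_splits)
    have b_supp: "T \<subseteq> V \<and> card T = i" if "b T \<noteq> 0" for T
      using that insert.prems(1)[of "insert x T"] by (auto simp: b_def split: if_splits)
    have b_cycle: "koszul y b T = 0" for T
    proof (cases "x \<in> T")
      case True
      then show ?thesis by (simp add: koszul_def b_def)
    next
      case False
      then show ?thesis
        using koszul_split(2)[OF False, of y c] insert.prems(2) unfolding b_def[abs_def] by simp
    qed
    have a_eq: "koszul y a T = - (y x * b T)" for T
    proof (cases "x \<in> T")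
      case True
      then show ?thesis by (simp add: koszul_def a_def b_def)
    next
      case False
      then show ?thesis
        using koszul_split(1)[OF False, of y c] insert.prems(2)[of T] unfolding a_def[abs_def]
        by (simp add: b_def add_eq_0_iff2)
    qed
    \<comment> \<open>In Koszul degree 0 the element \<open>b\<close> is a boundary by regularity, in positive degree by induction.\<close>
    obtain wb where wb_supp: "\<And>T. wb T \<noteq> 0 \<Longrightarrow> T \<subseteq> V \<and> card T = Suc i" and wb: "koszul y wb = b"
    proof (cases i)
      case 0
      have single: "a {u} = 0" if "u \<notin> V" for u
        using a_supp[of "{u}"] that by auto
      have "y x * b {} = - koszul y a {}" by (simp add: a_eq)
      also have "\<dots> = (\<Sum>u\<in>V. y u * (- a {u}))"
        unfolding koszul_def sum_negf[symmetric]
        by (rule sum.mono_neutral_cong_right) (auto simp: single)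
      finally obtain r where r: "b {} = (\<Sum>u\<in>V. y u * r u)"
        using regular[OF insert.hyps(2), of "b {}" "\<lambda>u. - a {u}"] by blast
      define wb where "wb T = (\<Sum>u\<in>V. if T = {u} then r u else 0)" for T
      have "koszul y wb T = b T" for T
      proof (cases "T = {}")
        case True
        have "koszul y wb {} = (\<Sum>u\<in>V. y u * r u)"
          unfolding koszul_def
          by (rule sum.mono_neutral_cong_right) (auto simp: wb_def intro: sum.neutral)
        then show ?thesis using True r by simp
      next
        case False
        then have "wb (insert z T) = 0" if "z \<notin> T" for z
          using that unfolding wb_def by (intro sum.neutral) auto
        moreover have "b T = 0" using False b_supp[of T] 0 by auto
        ultimately show ?thesis by (simp add: koszul_def)
      qed
      then have "koszul y wb = b" ..
      moreover have "T \<subseteq> V \<and> card T = Suc i" if nz: "wb T \<noteq> 0" for T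
      proof -
        have "\<exists>u\<in>V. T = {u}"
        proof (rule ccontr)
          assume "\<not> (\<exists>u\<in>V. T = {u})"
          then have "wb T = 0" unfolding wb_def by (intro sum.neutral) auto
          with nz show False by simp
        qed
        then show ?thesis using 0 by auto
      qed
      ultimately show ?thesis by (intro that)
    next
      case (Suc i')
      have "\<exists>w. (\<forall>T. w T \<noteq> 0 \<longrightarrow> T \<subseteq> V \<and> card T = Suc (Suc i')) \<and> koszul y w = b"
        using b_supp b_cycle Suc by (intro insert.IH) auto
      then obtain w where "\<And>T. w T \<noteq> 0 \<Longrightarrow> T \<subseteq> V \<and> card T = Suc (Suc i')" "koszul y w = b"
        by blast
      then show ?thesis unfolding Suc by (rule that[unfolded Suc])
    qed
    \<comment> \<open>The chain \<open>c\<close> is \<open>a + b e\<^sub>x\<close>, and \<open>b\<close> is the boundary of \<open>wb\<close>; subtracting the boundary of \<open>wb e\<^sub>x\<close> leaves a cycle free of \<open>x\<close>.\<close>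
    have "\<exists>w. (\<forall>T. w T \<noteq> 0 \<longrightarrow> T \<subseteq> V \<and> card T = Suc (Suc i)) \<and>
        koszul y w = (\<lambda>T. a T - y x * wb T)"
    proof (rule insert.IH)
      show "T \<subseteq> V \<and> card T = Suc i" if "a T - y x * wb T \<noteq> 0" for T
        using that a_supp[of T] wb_supp[of T] by (cases "a T = 0"; cases "wb T = 0") auto
      show "koszul y (\<lambda>T. a T - y x * wb T) T = 0" for T
      proof -
        have "koszul y (\<lambda>T. a T - y x * wb T) T = - (y x * b T + y x * b T)"
          unfolding koszul_diff koszul_scale wb a_eq by (simp only: minus_add_distrib diff_conv_add_uminus)
        then show ?thesis by (simp only: char2 minus_zero)
      qed
    qed
    then obtain w' where w'_supp: "\<And>T. w' T \<noteq> 0 \<Longrightarrow> T \<subseteq> V \<and> card T = Suc (Suc i)"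
      and w': "koszul y w' = (\<lambda>T. a T - y x * wb T)" by blast
    define w where "w T = (if x \<in> T then wb (T - {x}) else w' T)" for T
    have w'_x: "w' T = 0" if "x \<in> T" for T using w'_supp[of T] that insert.hyps by blast
    have wb_x: "wb T = 0" if "x \<in> T" for T using wb_supp[of T] that insert.hyps by blast
    have out: "koszul y w T = c T" if "x \<notin> T" for T
    proof -
      have "(\<lambda>T. if x \<in> T then 0 else w T) = w'" by (auto simp: w_def w'_x)
      then have "koszul y w T = y x * wb T + koszul y w' T"
        using koszul_split(1)[OF that, of y w] that by (simp add: w_def)
      then show ?thesis using that by (simp add: w' a_def)
    qed
    have ins: "koszul y w (insert x T) = c (insert x T)" if "x \<notin> T" for T
    proof -
      have "(\<lambda>T. if x \<in> T then 0 else w (insert x T)) = wb" by (auto simp: w_def wb_x)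
      then show ?thesis
        using koszul_split(2)[OF that, of y w] that by (simp add: wb b_def)
    qed
    have "koszul y w T = c T" for T
      using out[of T] ins[of "T - {x}"] by (cases "x \<in> T") (auto simp: insert_absorb)
    moreover have "T \<subseteq> insert x V \<and> card T = Suc (Suc i)" if "w T \<noteq> 0" for T
    proof (cases "x \<in> T")
      case True
      then have "T - {x} \<subseteq> V \<and> card (T - {x}) = Suc i"
        using that wb_supp[of "T - {x}"] by (simp add: w_def)
      then show ?thesis using True by (auto simp: card_Diff_singleton)
    next
      case False
      then show ?thesis using that w'_supp[of T] by (auto simp: w_def)
    qed
    ultimately show ?case by blast
  qed
qed


section \<open>The Koszul complex against a minimal free resolution\<close>

text \<open>Ideals generated by variables are monomial ideals, and membership can be read off the monomials. This makes
the variables a regular family in every order.\<close>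

lemma var_combination_iff:
  fixes f :: "('x::finite, 'k::field) mpol"
  shows "(\<exists>r. f = (\<Sum>x\<in>V. var x * r x)) \<longleftrightarrow> (\<forall>m\<in>Poly_Mapping.keys f. \<exists>x\<in>V. Poly_Mapping.lookup m x \<noteq> 0)"
proof
  assume "\<exists>r. f = (\<Sum>x\<in>V. var x * r x)"
  then obtain r where r: "f = (\<Sum>x\<in>V. var x * r x)" ..
  have "Poly_Mapping.lookup f m = 0" if "\<forall>x\<in>V. Poly_Mapping.lookup m x = 0" for m
    using that by (simp add: r lookup_sum lookup_var_mult)
  then show "\<forall>m\<in>Poly_Mapping.keys f. \<exists>x\<in>V. Poly_Mapping.lookup m x \<noteq> 0"
    by (metis in_keys_iff)
next
  assume "\<forall>m\<in>Poly_Mapping.keys f. \<exists>x\<in>V. Poly_Mapping.lookup m x \<noteq> 0"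
  then obtain \<xi> where \<xi>: "\<And>m. m \<in> Poly_Mapping.keys f \<Longrightarrow> \<xi> m \<in> V \<and> Poly_Mapping.lookup m (\<xi> m) \<noteq> 0"
    by metis
  define r where "r x = (\<Sum>m\<in>{m\<in>Poly_Mapping.keys f. \<xi> m = x}.
      Poly_Mapping.single (m - Poly_Mapping.single x 1) (Poly_Mapping.lookup f m))" for x
  have "var x * r x = (\<Sum>m\<in>{m\<in>Poly_Mapping.keys f. \<xi> m = x}. Poly_Mapping.single m (Poly_Mapping.lookup f m))" for x
  proof -
    have "var x * Poly_Mapping.single (m - Poly_Mapping.single x 1) c = Poly_Mapping.single m c"
      if "m \<in> Poly_Mapping.keys f" "\<xi> m = x" for m and c :: 'k
    proof -
      have "m = Poly_Mapping.single x 1 + (m - Poly_Mapping.single x 1)"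
        using \<xi>[OF that(1)] that(2) by (intro monomial_split) simp
      then show ?thesis by (simp add: var_def mult_single)
    qed
    then show ?thesis unfolding r_def sum_distrib_left by (intro sum.cong) auto
  qed
  then have "(\<Sum>x\<in>V. var x * r x)
      = (\<Sum>x\<in>V. \<Sum>m\<in>{m\<in>Poly_Mapping.keys f. \<xi> m = x}. Poly_Mapping.single m (Poly_Mapping.lookup f m))"
    by simp
  also have "\<dots> = f"
    using \<xi> by (subst sum.group) (auto simp: poly_sum_monomials[symmetric])
  finally show "\<exists>r. f = (\<Sum>x\<in>V. var x * r x)" by (intro exI[of _ r]) simp
qed

lemma var_regular:
  fixes b :: "('x::finite, 'k::field) mpol"
  assumes "x \<notin> V" "var x * b = (\<Sum>u\<in>V. var u * r u)"
  shows "\<exists>r. b = (\<Sum>u\<in>V. var u * r u)"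
  unfolding var_combination_iff
proof
  fix m assume "m \<in> Poly_Mapping.keys b"
  then have "Poly_Mapping.single x 1 + m \<in> Poly_Mapping.keys (var x * b)"
    unfolding var_def by (subst keys_single_mult) auto
  moreover have "\<exists>r. var x * b = (\<Sum>u\<in>V. var u * r u)" using assms(2) by blast
  ultimately obtain u where "u \<in> V" "Poly_Mapping.lookup (Poly_Mapping.single x 1 + m) u \<noteq> 0"
    unfolding var_combination_iff by blast
  then show "\<exists>u\<in>V. Poly_Mapping.lookup m u \<noteq> 0"
    using assms(1) by (auto simp: lookup_add lookup_single when_def split: if_splits)
qed

lemma zero_const_coeff_combination:
  fixes f :: "('x::finite, 'k::field) mpol"
  assumes "Poly_Mapping.lookup f 0 = 0"
  shows "\<exists>r. f = (\<Sum>x\<in>UNIV. var x * r x)"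
  unfolding var_combination_iff
proof
  fix m assume "m \<in> Poly_Mapping.keys f"
  then have "m \<noteq> 0" using assms by (auto simp: in_keys_iff)
  then show "\<exists>x\<in>UNIV. Poly_Mapping.lookup m x \<noteq> 0"
    by (auto simp: poly_mapping_eq_iff fun_eq_iff)
qed

lemma irrelevant_const_coeff:
  fixes f :: "('x::finite, 'k::field) mpol"
  assumes "f \<in> irrelevant_ideal"
  shows "Poly_Mapping.lookup f 0 = 0"
  using assms unfolding irrelevant_ideal_def
proof (induction rule: ideal_gen_induct)
  case (step c x y)
  then show ?case by (auto simp: lookup_add mult.commute[of c] lookup_var_mult)
qed simp

text \<open>A minimal free resolution of the quotient by \<open>J\<close>, with matrices given by their entries. Elements of a free
module are families of polynomials of which only the entries below the rank matter.\<close>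

locale resolution =
  fixes \<beta> :: "nat \<Rightarrow> nat"
    and \<phi> :: "nat \<Rightarrow> nat \<Rightarrow> nat \<Rightarrow> ('x::finite, 'k::field) mpol"
    and J :: "('x, 'k) mpol set"
  assumes char2: "(r :: 'k) + r = 0"
    and rank_0: "\<beta> 0 = 1"
    and minimal: "k < \<beta> i \<Longrightarrow> l < \<beta> (Suc i) \<Longrightarrow> Poly_Mapping.lookup (\<phi> i k l) 0 = 0"
    and image_0: "F \<in> J \<longleftrightarrow> (\<exists>g. F = (\<Sum>l<\<beta> (Suc 0). \<phi> 0 0 l * g l))"
    and exact: "(\<And>k. k < \<beta> i \<Longrightarrow> (\<Sum>l<\<beta> (Suc i). \<phi> i k l * f l) = 0) \<Longrightarrow>
      \<exists>g. \<forall>l<\<beta> (Suc i). f l = (\<Sum>q<\<beta> (Suc (Suc i)). \<phi> (Suc i) l q * g q)"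
    and complex: "k < \<beta> i \<Longrightarrow>
      (\<Sum>l<\<beta> (Suc i). \<phi> i k l * (\<Sum>q<\<beta> (Suc (Suc i)). \<phi> (Suc i) l q * g q)) = 0"
begin

text \<open>Koszul chains of degree \<open>i\<close> with coefficients in the free module in position \<open>j\<close>.\<close>

definition bichains :: "nat \<Rightarrow> nat \<Rightarrow> ('x set \<Rightarrow> nat \<Rightarrow> ('x, 'k) mpol) set" where
  "bichains i j = {c. \<forall>T k. c T k \<noteq> 0 \<longrightarrow> card T = i \<and> k < \<beta> j}"

definition kos :: "('x set \<Rightarrow> nat \<Rightarrow> ('x, 'k) mpol) \<Rightarrow> 'x set \<Rightarrow> nat \<Rightarrow> ('x, 'k) mpol" where
  "kos c T k = koszul var (\<lambda>T. c T k) T"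

definition res :: "nat \<Rightarrow> ('x set \<Rightarrow> nat \<Rightarrow> ('x, 'k) mpol) \<Rightarrow> 'x set \<Rightarrow> nat \<Rightarrow> ('x, 'k) mpol" where
  "res j c T k = (if k < \<beta> j then \<Sum>l<\<beta> (Suc j). \<phi> j k l * c T l else 0)"

lemma char2_poly: "(f :: ('x, 'k) mpol) + f = 0"
  by (rule poly_mapping_eqI) (simp only: lookup_add char2 lookup_zero)

lemma bichains_zero: "c \<in> bichains i j \<Longrightarrow> card T \<noteq> i \<or> k \<ge> \<beta> j \<Longrightarrow> c T k = 0"
  unfolding bichains_def by (auto simp: not_less[symmetric])

lemma kos_in:
  assumes "c \<in> bichains (Suc i) j"
  shows "kos c \<in> bichains i j"
  unfolding bichains_def
proof safe
  fix T k assume "kos c T k \<noteq> 0"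
  then obtain x where "x \<notin> T" "c (insert x T) k \<noteq> 0"
    unfolding kos_def koszul_def by (metis (no_types, lifting) ComplD mult_zero_right sum.neutral)
  moreover from this have "card (insert x T) = Suc i \<and> k < \<beta> j"
    using assms by (auto simp: bichains_def)
  ultimately show "card T = i" "k < \<beta> j" by simp_all
qed

lemma res_in:
  assumes "c \<in> bichains i (Suc j)"
  shows "res j c \<in> bichains i j"
  unfolding bichains_def mem_Collect_eq
proof (intro allI impI)
  fix T k assume nz: "res j c T k \<noteq> 0"
  then have "k < \<beta> j" by (simp add: res_def split: if_splits)
  moreover have "res j c T k = 0" if "card T \<noteq> i"
    using that by (simp add: res_def bichains_zero[OF assms])
  ultimately show "card T = i \<and> k < \<beta> j" using nz by blast
qed

lemma kos_exact:
  assumes c: "c \<in> bichains (Suc i) j" and "kos c = 0"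
  shows "c \<in> kos ` bichains (Suc (Suc i)) j"
proof -
  have "\<exists>w. (\<forall>T. w T \<noteq> 0 \<longrightarrow> T \<subseteq> UNIV \<and> card T = Suc (Suc i)) \<and> koszul var w = (\<lambda>T. c T k)" for k
  proof (rule koszul_exact)
    show "\<exists>r. b = (\<Sum>u\<in>V. var u * r u)"
      if "x \<notin> V" "var x * b = (\<Sum>u\<in>V. var u * r u)" for V x b and r :: "'x \<Rightarrow> ('x, 'k) mpol"
      using that by (rule var_regular)
    show "T \<subseteq> UNIV \<and> card T = Suc i" if "c T k \<noteq> 0" for T
      using that c by (auto simp: bichains_def)
    show "koszul var (\<lambda>T. c T k) T = 0" for T
      using fun_cong[OF fun_cong[OF assms(2)], of T k] by (simp add: kos_def)
  qed (rule char2_poly)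
  then obtain w where w: "\<And>k T. w k T \<noteq> 0 \<Longrightarrow> card T = Suc (Suc i)"
      "\<And>k. koszul var (w k) = (\<lambda>T. c T k)"
    by metis
  define w' where "w' T k = (if k < \<beta> j then w k T else 0)" for T k
  have "w' \<in> bichains (Suc (Suc i)) j"
    using w(1) by (auto simp: w'_def bichains_def)
  moreover have "kos w' = c"
  proof (intro ext)
    fix T k
    show "kos w' T k = c T k"
      using w(2)[of k] bichains_zero[OF c, of T k]
      by (cases "k < \<beta> j") (simp_all add: kos_def w'_def, simp add: koszul_def)
  qed
  ultimately show ?thesis by blast
qed

lemma res_exact:
  assumes c: "c \<in> bichains i (Suc j)" and 0: "res j c = 0"
  shows "c \<in> res (Suc j) ` bichains i (Suc (Suc j))"
proof -
  have "\<exists>g. \<forall>l<\<beta> (Suc j). c T l = (\<Sum>q<\<beta> (Suc (Suc j)). \<phi> (Suc j) l q * g q)" for T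
  proof (rule exact)
    fix k assume "k < \<beta> j"
    then show "(\<Sum>l<\<beta> (Suc j). \<phi> j k l * c T l) = 0"
      using fun_cong[OF fun_cong[OF 0], of T k] by (simp add: res_def)
  qed
  then obtain g where g: "\<And>T l. l < \<beta> (Suc j) \<Longrightarrow>
      c T l = (\<Sum>q<\<beta> (Suc (Suc j)). \<phi> (Suc j) l q * g T q)" by metis
  define w where "w T q = (if card T = i \<and> q < \<beta> (Suc (Suc j)) then g T q else 0)" for T q
  have "w \<in> bichains i (Suc (Suc j))" by (auto simp: w_def bichains_def)
  moreover have "res (Suc j) w = c"
  proof (intro ext)
    fix T k
    show "res (Suc j) w T k = c T k"
      using g[of k T] bichains_zero[OF c, of T k]
      by (cases "card T = i"; cases "k < \<beta> (Suc j)") (auto simp: res_def w_def)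
  qed
  ultimately show ?thesis by blast
qed

sublocale double_complex bichains "\<lambda>_. kos" res
proof
  show "x - y \<in> bichains i j" if "x \<in> bichains i j" "y \<in> bichains i j" for x y i j
    using that unfolding bichains_def by auto metis+
  show "kos (x - y) = kos x - kos y" for x y
    by (intro ext) (simp add: kos_def koszul_diff)
  show "res j (x - y) = res j x - res j y" for j x y
    by (intro ext) (simp add: res_def right_diff_distrib sum_subtractf)
  show "kos (res j x) = res j (kos x)" for j x
  proof (intro ext)
    fix T k
    show "kos (res j x) T k = res j (kos x) T k"
    proof (cases "k < \<beta> j")
      case True
      have "kos (res j x) T k = (\<Sum>y\<in>-T. \<Sum>l<\<beta> (Suc j). var y * (\<phi> j k l * x (insert y T) l))"
        using True by (simp add: kos_def koszul_def res_def sum_distrib_left)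
      also have "\<dots> = (\<Sum>l<\<beta> (Suc j). \<Sum>y\<in>-T. \<phi> j k l * (var y * x (insert y T) l))"
        unfolding mult.left_commute[of "var _"] by (rule sum.swap)
      also have "\<dots> = res j (kos x) T k"
        using True by (simp add: kos_def koszul_def res_def sum_distrib_left)
      finally show ?thesis .
    qed (simp add: kos_def koszul_def res_def)
  qed
  show "kos (kos x) = 0" for x
    by (intro ext) (simp add: kos_def koszul_koszul char2_poly)
  show "res j (res (Suc j) x) = 0" for j x
    by (intro ext) (simp add: res_def complex)
qed (auto intro: kos_in res_in kos_exact res_exact)

lemma insert_compl: "insert x (- {x}) = UNIV"
  by auto

lemma zero_chains: "0 \<in> bichains i j"
  by (simp add: bichains_def)

lemma kos_zero: "kos 0 = 0"
  by (intro ext) (simp add: kos_def koszul_def)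

lemma res_zero: "res j 0 = 0"
  by (intro ext) (simp add: res_def)

text \<open>In Koszul degree 0 the boundaries are the vectors with entries in the irrelevant ideal, which is generated by the
variables.\<close>

lemma degree_0_boundary:
  assumes "\<And>k. k < \<beta> j \<Longrightarrow> Poly_Mapping.lookup (f k) 0 = 0"
  shows "(\<lambda>T k. if T = {} \<and> k < \<beta> j then f k else 0) \<in> kos ` bichains (Suc 0) j"
proof -
  have "\<exists>r. k < \<beta> j \<longrightarrow> f k = (\<Sum>x\<in>UNIV. var x * r x)" for k
    using zero_const_coeff_combination[of "f k"] assms by blast
  then obtain r where r: "\<And>k. k < \<beta> j \<Longrightarrow> f k = (\<Sum>x\<in>UNIV. var x * r k x)" by metis
  define w where "w T k = (if card T = Suc 0 \<and> k < \<beta> j then r k (the_elem T) else 0)" for T k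
  have "w \<in> bichains (Suc 0) j" by (auto simp: w_def bichains_def)
  moreover have "kos w = (\<lambda>T k. if T = {} \<and> k < \<beta> j then f k else 0)"
  proof (intro ext)
    fix T k
    show "kos w T k = (if T = {} \<and> k < \<beta> j then f k else 0)"
      by (cases "T = {}") (auto simp: kos_def koszul_def w_def r intro!: sum.neutral)
  qed
  ultimately show ?thesis by (metis imageI)
qed

text \<open>A generator of the last free module is mapped by minimality to Koszul boundaries, so a zigzag leads from it to
Koszul degree \<open>p\<close> with coefficients in the quotient by \<open>J\<close>. If \<open>p\<close> is at least the number of variables,
the Koszul homology there vanishes, because some variable is a nonzerodivisor modulo \<open>J\<close>. The generator would
then be a boundary, contradicting that its constant term is nonzero.\<close>

lemma length_less_card:
  assumes nonzero: "\<beta> p \<noteq> 0" and last: "\<beta> (Suc p) = 0"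
    and regular: "\<And>F. var x0 * F \<in> J \<Longrightarrow> F \<in> J"
  shows "p < CARD('x)"
proof (rule ccontr)
  assume "\<not> p < CARD('x)"
  then have p: "CARD('x) \<le> p" by simp
  then have p_pos: "0 < p" using zero_less_card_finite[where 'a = 'x] by linarith
  define q where "q = p - Suc 0"
  have q: "p = Suc q" using p_pos by (simp add: q_def)
  \<comment> \<open>The chase starts in the last free module, hence it runs in the transposed double complex.\<close>
  interpret t: double_complex "\<lambda>i j. bichains j i" res "\<lambda>_. kos"
    by (rule double_complex_transpose) unfold_locales
  define e :: "'x set \<Rightarrow> nat \<Rightarrow> ('x, 'k) mpol" where "e T k = (if T = {} \<and> k = 0 then 1 else 0)" for T k
  have "res q e = (\<lambda>T k. if T = {} \<and> k < \<beta> q then \<phi> q k 0 else 0)"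
  proof (intro ext)
    fix T k
    have "(\<Sum>l<\<beta> p. \<phi> q k l * e T l) = (\<Sum>l<\<beta> p. if l = 0 then (if T = {} then \<phi> q k 0 else 0) else 0)"
      by (intro sum.cong) (auto simp: e_def)
    then show "res q e T k = (if T = {} \<and> k < \<beta> q then \<phi> q k 0 else 0)"
      using nonzero by (cases "T = {}") (simp_all add: res_def q[symmetric])
  qed
  then have "res (p - Suc 0) e \<in> kos ` bichains (Suc 0) (p - Suc 0)"
    using degree_0_boundary[of q "\<lambda>k. \<phi> q k 0"] minimal[of _ q 0] nonzero
    by (simp add: q_def[symmetric] q[symmetric])
  moreover have "e \<in> bichains 0 p" using nonzero by (auto simp: e_def bichains_def)
  ultimately obtain z where z: "t.zigzag p z" and z0: "z 0 = e"
    using t.zigzag_exists[of e p] by blast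
  define F where "F = z p UNIV 0"
  have zp: "z p \<in> bichains p 0" using z by (auto simp: t.zigzag_def)
  have "F \<in> J"
  proof (cases "p = CARD('x)")
    case True
    \<comment> \<open>The last step of the zigzag puts \<open>var x0 * F\<close> into the image of the first matrix.\<close>
    have step: "res 0 (z q) = kos (z p)"
      using z p_pos unfolding t.zigzag_def q_def by (metis Suc_pred diff_self_eq_0 lessI One_nat_def)
    have "kos (z p) (- {x0}) 0 = var x0 * F"
      by (simp add: kos_def koszul_def F_def insert_compl)
    moreover have "res 0 (z q) (- {x0}) 0 \<in> J"
      using rank_0 unfolding image_0 by (auto simp: res_def)
    ultimately have "var x0 * F \<in> J" by (simp only: step)
    then show ?thesis by (rule regular)
  next
    case False
    then have "F = 0" using bichains_zero[OF zp] by (auto simp: F_def)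
    then show ?thesis unfolding image_0 by (intro exI[of _ "\<lambda>_. 0"]) simp
  qed
  then obtain g where g: "F = (\<Sum>l<\<beta> (Suc 0). \<phi> 0 0 l * g l)" unfolding image_0 by blast
  define w where "w T l = (if card T = p \<and> l < \<beta> (Suc 0) then g l else 0)" for T :: "'x set" and l
  have w: "w \<in> bichains p (Suc 0)" by (auto simp: w_def bichains_def)
  have "z p = res 0 w"
  proof (intro ext)
    fix T k
    show "z p T k = res 0 w T k"
    proof (cases "card T = p \<and> k = 0")
      case True
      then have "T = UNIV" using p card_mono[of UNIV T] by (intro card_eq_UNIV_imp_eq_UNIV) auto
      then show ?thesis using True rank_0 g by (simp add: F_def res_def w_def)
    next
      case False
      then show ?thesis using bichains_zero[OF zp, of T k] rank_0 by (auto simp: res_def w_def)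
    qed
  qed
  then have "z p = res 0 w + kos 0" by (simp add: kos_zero)
  from t.zigzag_boundary[OF z this w zero_chains] obtain w u
    where "e = res p w + kos u" unfolding z0 by blast
  then have "e {} 0 = res p w {} 0 + kos u {} 0" by simp
  then have "(1 :: ('x, 'k) mpol) = (\<Sum>x\<in>UNIV. var x * u {x} 0)"
    using nonzero by (simp add: e_def res_def last kos_def koszul_def)
  moreover have "Poly_Mapping.lookup (\<Sum>x\<in>UNIV. var x * u {x} 0) 0 = 0"
    by (simp add: lookup_sum lookup_var_mult)
  ultimately have "Poly_Mapping.lookup (1 :: ('x, 'k) mpol) 0 = 0" by (simp only:)
  then show False by simp
qed

lemma kos_linear:
  "kos (\<lambda>T k. r * c T k + s * c' T k) = (\<lambda>T k. r * kos c T k + s * kos c' T k)"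
  by (intro ext) (simp add: kos_def koszul_def sum_distrib_left sum.distrib algebra_simps)

lemma res_linear:
  "res j (\<lambda>T k. r * c T k + s * c' T k) = (\<lambda>T k. r * res j c T k + s * res j c' T k)"
  by (intro ext) (simp add: res_def sum_distrib_left sum.distrib algebra_simps)

text \<open>Chains of Koszul degree one less than the number of variables are families \<open>a\<close> indexed by the omitted variable,
and the hypothesis says that the family is a cycle modulo \<open>J\<close>.\<close>

lemma penultimate_zigzag:
  fixes a :: "'x \<Rightarrow> ('x, 'k) mpol"
  assumes n: "CARD('x) = Suc n" "0 < n"
    and cycle: "\<And>x y. x \<noteq> y \<Longrightarrow> var x * a y + var y * a x \<in> J"
  shows "\<exists>z. zigzag n z \<and> (\<forall>x. z 0 (- {x}) 0 = a x)"
proof -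
  define c where "c T k = (if card T = n \<and> k = 0 then a (the_elem (- T)) else 0)" for T and k :: nat
  \<comment> \<open>The sets of size \<open>n\<close> are the complements of single variables.\<close>
  have card_compl: "card (- {x}) = n" for x :: 'x
    using n by (simp add: Compl_eq_Diff_UNIV card_Diff_subset)
  have "kos c T 0 \<in> J" for T
  proof (cases "card T = n - Suc 0")
    case True
    then have "card (- T) = 2" using n by (simp add: Compl_eq_Diff_UNIV card_Diff_subset)
    then obtain x y where xy: "- T = {x, y}" "x \<noteq> y" by (auto simp: card_2_iff)
    then have "insert x T = - {y}" "insert y T = - {x}" by auto
    then show ?thesis
      using cycle[OF xy(2)] xy(2) by (simp add: kos_def koszul_def xy(1) c_def card_compl)
  next
    case False
    have "kos c T 0 = 0" unfolding kos_def koszul_def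
      using False by (intro sum.neutral) (auto simp: c_def)
    then show ?thesis unfolding image_0 by (intro exI[of _ "\<lambda>_. 0"]) simp
  qed
  then obtain g where g: "\<And>T. kos c T 0 = (\<Sum>l<\<beta> (Suc 0). \<phi> 0 0 l * g T l)"
    unfolding image_0 by metis
  define y where "y T l = (if card T = n - Suc 0 \<and> l < \<beta> (Suc 0) then g T l else 0)" for T l
  have c: "c \<in> bichains n 0" using rank_0 by (auto simp: c_def bichains_def)
  have kc: "kos c \<in> bichains (n - Suc 0) 0" using c n(2) by (intro kos_in) simp
  have "kos c = res 0 y"
  proof (intro ext)
    fix T k
    show "kos c T k = res 0 y T k"
      using bichains_zero[OF kc, of T k] g[of T] rank_0
      by (cases "card T = n - Suc 0"; cases "k = 0") (simp_all add: res_def y_def)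
  qed
  moreover have "y \<in> bichains (n - Suc 0) (Suc 0)" by (auto simp: y_def bichains_def)
  ultimately obtain z where "zigzag n z" "z 0 = c" using zigzag_exists[OF c] by blast
  moreover have "c (- {x}) 0 = a x" for x by (simp add: c_def card_compl)
  ultimately show ?thesis by blast
qed

text \<open>The far ends of the two zigzags lie in a free module of rank at most 1, so some combination of the two cycles ends
in an element without constant term. Such an element is a Koszul boundary, and then so is the combined cycle, modulo
\<open>J\<close>. The polynomial \<open>F\<close> is the chain of top Koszul degree that bounds it.\<close>

lemma penultimate_cycles_dependent:
  fixes a b :: "'x \<Rightarrow> ('x, 'k) mpol"
  assumes n: "CARD('x) = Suc n" "0 < n" and rank: "\<beta> n \<le> 1"
    and a: "\<And>x y. x \<noteq> y \<Longrightarrow> var x * a y + var y * a x \<in> J"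
    and b: "\<And>x y. x \<noteq> y \<Longrightarrow> var x * b y + var y * b x \<in> J"
  shows "\<exists>\<sigma> \<tau> F. (\<sigma> \<noteq> 0 \<or> \<tau> \<noteq> 0) \<and>
    (\<forall>x. Poly_Mapping.single 0 \<sigma> * a x + Poly_Mapping.single 0 \<tau> * b x - var x * F \<in> J)"
proof -
  obtain z z' where z: "zigzag n z" "\<And>x. z 0 (- {x}) 0 = a x"
    and z': "zigzag n z'" "\<And>x. z' 0 (- {x}) 0 = b x"
    using penultimate_zigzag[OF n] a b by metis
  have "\<exists>\<sigma> \<tau>. (\<sigma> \<noteq> 0 \<or> \<tau> \<noteq> 0) \<and> \<sigma> * s + \<tau> * t = 0" for s t :: 'k
  proof (cases "s = 0 \<and> t = 0")
    case True
    then show ?thesis by (intro exI[of _ 1] exI[of _ 0]) simp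
  next
    case False
    then show ?thesis by (intro exI[of _ t] exI[of _ "- s"]) auto
  qed
  then obtain \<sigma> \<tau> where nz: "\<sigma> \<noteq> 0 \<or> \<tau> \<noteq> 0"
    and lin: "\<sigma> * Poly_Mapping.lookup (z n {} 0) 0 + \<tau> * Poly_Mapping.lookup (z' n {} 0) 0 = 0"
    by blast
  define y where "y j = (\<lambda>T k. Poly_Mapping.single 0 \<sigma> * z j T k + Poly_Mapping.single 0 \<tau> * z' j T k)" for j
  have "y j \<in> bichains i j'" if "z j \<in> bichains i j'" "z' j \<in> bichains i j'" for i j j'
    unfolding bichains_def mem_Collect_eq
  proof (intro allI impI)
    fix T k assume "y j T k \<noteq> 0"
    then have "z j T k \<noteq> 0 \<or> z' j T k \<noteq> 0" by (auto simp: y_def)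
    then show "card T = i \<and> k < \<beta> j'" using that unfolding bichains_def by blast
  qed
  moreover have "kos (y j) = res j (y (Suc j))"
    if "kos (z j) = res j (z (Suc j))" "kos (z' j) = res j (z' (Suc j))" for j
    unfolding y_def kos_linear res_linear that ..
  ultimately have y: "zigzag n y"
    using z(1) z'(1) unfolding zigzag_def by blast
  have yn: "y n \<in> bichains 0 n" using y by (auto simp: zigzag_def)
  have "y n = (\<lambda>T k. if T = {} \<and> k < \<beta> n then y n {} 0 else 0)"
  proof (intro ext)
    fix T k
    show "y n T k = (if T = {} \<and> k < \<beta> n then y n {} 0 else 0)"
      using bichains_zero[OF yn, of T k] rank by (cases "k = 0") auto
  qed
  also have "\<dots> \<in> kos ` bichains (Suc 0) n"
    using lin by (intro degree_0_boundary) (simp add: y_def lookup_add)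
  finally obtain w where w: "w \<in> bichains (Suc 0) n" "y n = kos w + res n 0"
    by (auto simp: res_zero)
  from zigzag_boundary[OF y w(2,1) zero_chains] obtain w u where wu: "y 0 = kos w + res 0 u"
    by blast
  have "Poly_Mapping.single 0 \<sigma> * a x + Poly_Mapping.single 0 \<tau> * b x - var x * w UNIV 0 \<in> J" for x
  proof -
    have "y 0 (- {x}) 0 = kos w (- {x}) 0 + res 0 u (- {x}) 0" by (simp add: wu)
    then have "Poly_Mapping.single 0 \<sigma> * a x + Poly_Mapping.single 0 \<tau> * b x - var x * w UNIV 0
        = (\<Sum>l<\<beta> (Suc 0). \<phi> 0 0 l * u (- {x}) l)"
      using rank_0 by (simp add: y_def z z' kos_def koszul_def res_def insert_compl)
    then show ?thesis unfolding image_0 by blast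
  qed
  with nz show ?thesis by blast
qed

end


section \<open>The socle of a Gorenstein set of points\<close>

lemma char2_add:
  assumes "CHAR('k::field) = 2"
  shows "(r :: 'k) + r = 0"
proof -
  have "(of_nat 2 :: 'k) = 0" using of_nat_CHAR[where 'a = 'k] assms by simp
  then have "of_nat 2 * r = 0" by simp
  then show ?thesis by simp
qed

lemma resolution_of_matrices:
  fixes \<phi> :: "nat \<Rightarrow> ('x::finite, 'k::field) mpol mat"
  assumes "min_graded_free_resolution J p \<beta> d \<phi>" and "CHAR('k) = 2"
  shows "resolution \<beta> (\<lambda>i k l. \<phi> i $$ (k, l)) J"
proof -
  from assms(1)[unfolded min_graded_free_resolution_def]
  have rank_0: "\<beta> 0 = 1"
    and dims: "\<forall>i. \<phi> i \<in> carrier_mat (\<beta> i) (\<beta> (Suc i))"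
    and entries: "\<forall>i. \<forall>k<\<beta> i. \<forall>j<\<beta> (Suc i). \<phi> i $$ (k, j) \<in> irrelevant_ideal"
    and image_0: "{\<phi> 0 *\<^sub>v v | v. v \<in> carrier_vec (\<beta> 1)} = {w \<in> carrier_vec 1. w $ 0 \<in> J}"
    and kernels: "\<forall>i. {\<phi> (Suc i) *\<^sub>v v | v. v \<in> carrier_vec (\<beta> (i + 2))} = mat_kernel (\<phi> i)"
    by - (elim conjE, assumption)+
  note dim = dims[rule_format] and kernel = kernels[rule_format]
  have mult: "(\<phi> i *\<^sub>v v) $ k = (\<Sum>l<\<beta> (Suc i). \<phi> i $$ (k, l) * v $ l)"
    if "k < \<beta> i" "v \<in> carrier_vec (\<beta> (Suc i))" for i k v
    using that dim[of i] by (simp add: scalar_prod_def atLeast0LessThan)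
  have mult_vec: "(\<phi> i *\<^sub>v vec (\<beta> (Suc i)) f) $ k = (\<Sum>l<\<beta> (Suc i). \<phi> i $$ (k, l) * f l)"
    if "k < \<beta> i" for i k f
    using mult[of k i "vec (\<beta> (Suc i)) f"] that by simp
  show ?thesis
  proof
    show "Poly_Mapping.lookup (\<phi> i $$ (k, l)) 0 = 0" if "k < \<beta> i" "l < \<beta> (Suc i)" for i k l
      using entries that by (intro irrelevant_const_coeff) blast
    show "F \<in> J \<longleftrightarrow> (\<exists>g. F = (\<Sum>l<\<beta> (Suc 0). \<phi> 0 $$ (0, l) * g l))" for F
    proof
      assume "F \<in> J"
      then have "vec 1 (\<lambda>_. F) \<in> {\<phi> 0 *\<^sub>v v | v. v \<in> carrier_vec (\<beta> 1)}"
        unfolding image_0 by simp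
      then obtain v where v: "vec 1 (\<lambda>_. F) = \<phi> 0 *\<^sub>v v" "v \<in> carrier_vec (\<beta> (Suc 0))" by auto
      have "F = vec 1 (\<lambda>_. F) $ 0" by simp
      also have "\<dots> = (\<phi> 0 *\<^sub>v v) $ 0" using v(1) by (rule arg_cong)
      also have "\<dots> = (\<Sum>l<\<beta> (Suc 0). \<phi> 0 $$ (0, l) * v $ l)"
        using rank_0 v(2) by (intro mult) simp_all
      finally have "F = (\<Sum>l<\<beta> (Suc 0). \<phi> 0 $$ (0, l) * v $ l)" .
      then show "\<exists>g. F = (\<Sum>l<\<beta> (Suc 0). \<phi> 0 $$ (0, l) * g l)" by blast
    next
      assume "\<exists>g. F = (\<Sum>l<\<beta> (Suc 0). \<phi> 0 $$ (0, l) * g l)"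
      then obtain g where g: "F = (\<Sum>l<\<beta> (Suc 0). \<phi> 0 $$ (0, l) * g l)" by blast
      have "\<phi> 0 *\<^sub>v vec (\<beta> 1) g \<in> {w \<in> carrier_vec 1. w $ 0 \<in> J}"
        unfolding image_0[symmetric] by auto
      then show "F \<in> J" using mult_vec[of 0 0 g] rank_0 g by simp
    qed
    show "\<exists>g. \<forall>l<\<beta> (Suc i). f l = (\<Sum>q<\<beta> (Suc (Suc i)). \<phi> (Suc i) $$ (l, q) * g q)"
      if "\<And>k. k < \<beta> i \<Longrightarrow> (\<Sum>l<\<beta> (Suc i). \<phi> i $$ (k, l) * f l) = 0" for i f
    proof -
      have "vec (\<beta> (Suc i)) f \<in> mat_kernel (\<phi> i)"
        using that dim[of i] mult_vec[of _ i f] by (intro mat_kernelI[OF dim[of i]]) auto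
      then obtain v where v: "vec (\<beta> (Suc i)) f = \<phi> (Suc i) *\<^sub>v v" "v \<in> carrier_vec (\<beta> (Suc (Suc i)))"
        unfolding kernel[symmetric] by auto
      have "f l = (\<Sum>q<\<beta> (Suc (Suc i)). \<phi> (Suc i) $$ (l, q) * v $ q)" if "l < \<beta> (Suc i)" for l
        using mult[OF that v(2)] that unfolding v(1)[symmetric] by simp
      then show ?thesis by blast
    qed
    show "(\<Sum>l<\<beta> (Suc i). \<phi> i $$ (k, l) * (\<Sum>q<\<beta> (Suc (Suc i)). \<phi> (Suc i) $$ (l, q) * g q)) = 0"
      if "k < \<beta> i" for k i g
    proof -
      let ?w = "\<phi> (Suc i) *\<^sub>v vec (\<beta> (Suc (Suc i))) g"
      have w: "?w \<in> mat_kernel (\<phi> i)" unfolding kernel[symmetric] by auto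
      have "(\<Sum>l<\<beta> (Suc i). \<phi> i $$ (k, l) * (\<Sum>q<\<beta> (Suc (Suc i)). \<phi> (Suc i) $$ (l, q) * g q))
          = (\<phi> i *\<^sub>v ?w) $ k"
        using mult[OF that mat_kernelD(1)[OF dim w]] mult_vec[of _ "Suc i" g] by simp
      also have "\<dots> = 0" using mat_kernelD(2)[OF dim w] that by simp
      finally show ?thesis .
    qed
  qed (use rank_0 char2_add[OF assms(2)] in auto)
qed

lemma vanishing_add:
  "f \<in> vanishing_ideal X \<Longrightarrow> g \<in> vanishing_ideal X \<Longrightarrow> f + g \<in> vanishing_ideal X"
  by (simp add: vanishing_ideal_def)

text \<open>A relation \<open>x\<^sub>j f = g\<^sub>j\<close> on the points, with \<open>f\<close> and all \<open>g\<^sub>j\<close> of degree at most \<open>e\<close>, makes the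
homogenizations in degree \<open>e\<close> of \<open>f\<close> and of the \<open>g\<^sub>j\<close> a Koszul cycle modulo the homogenized ideal: \<open>f\<close>
is the component omitting \<open>u\<close>, and \<open>g\<^sub>j\<close> the one omitting \<open>x\<^sub>j\<close>. The cycle conditions are
\<open>u g\<^sub>j = x\<^sub>j f\<close> and \<open>x\<^sub>i g\<^sub>j = x\<^sub>j g\<^sub>i\<close>. The conclusion is the \<open>u\<close>-component of the statement
that a combination of two such cycles bounds.\<close>

lemma gorenstein_socle_dependent:
  fixes f f' :: "('x::finite, 'k::field) mpol"
  assumes char: "CHAR('k) = 2" and gor: "gorenstein (vanishing_ideal X)"
    and f: "f \<in> polys_lt (Suc e)" "\<And>j. g j \<in> polys_lt (Suc e)" "\<And>j. var j * f - g j \<in> vanishing_ideal X"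
    and f': "f' \<in> polys_lt (Suc e')" "\<And>j. g' j \<in> polys_lt (Suc e')" "\<And>j. var j * f' - g' j \<in> vanishing_ideal X"
  shows "\<exists>\<sigma> \<tau> F. (\<sigma> \<noteq> 0 \<or> \<tau> \<noteq> 0) \<and>
    Poly_Mapping.single 0 \<sigma> * homogenize e f + Poly_Mapping.single 0 \<tau> * homogenize e' f' - var None * F
      \<in> homog_ideal (vanishing_ideal X)"
proof -
  let ?J = "homog_ideal (vanishing_ideal X)"
  obtain p \<beta> d \<phi> where res: "min_graded_free_resolution ?J p \<beta> d \<phi>" and last: "\<beta> p = 1"
    using gor unfolding gorenstein_def gorenstein_quot_def by blast
  interpret resolution \<beta> "\<lambda>i k l. \<phi> i $$ (k, l)" ?J
    using res char by (rule resolution_of_matrices)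
  have beyond: "\<beta> i = 0" if "i > p" for i
    using res[unfolded min_graded_free_resolution_def, THEN conjunct2, THEN conjunct1] that by blast
  have "p < CARD('x option)"
    using last beyond[of "Suc p"] homog_var_regular by (intro length_less_card[of p None]) auto
  then have rank: "\<beta> (CARD('x)) \<le> 1"
    using last beyond[of "CARD('x)"] by (cases "p = CARD('x)") (auto simp: card_option)
  have cycle: "var x * a y + var y * a x \<in> ?J"
    if h: "h \<in> polys_lt (Suc c)" "\<And>j. b j \<in> polys_lt (Suc c)" "\<And>j. var j * h - b j \<in> vanishing_ideal X"
      and a: "a = case_option (homogenize c h) (\<lambda>j. homogenize c (b j))" and xy: "x \<noteq> y"
    for h :: "('x, 'k) mpol" and b c a and x y :: "'x option"
  proof -
    have lt: "k \<in> polys_lt (Suc (Suc c))" if "k \<in> polys_lt (Suc c)" for k :: "('x, 'k) mpol"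
      using that by (rule polys_lt_mono) simp
    have eq: "eval_mpol (b j) p = p j * eval_mpol h p" if "p \<in> X" for j p
      using h(3)[of j] that by (simp add: vanishing_ideal_def)
    have mixed: "var None * homogenize c (b j) + var (Some j) * homogenize c h \<in> ?J" for j
    proof -
      have "eval_mpol (b j + var j * h) p = 0" if "p \<in> X" for p
        by (simp only: eval_add eval_var_mult eq[OF that] char2_add[OF char])
      then have mem: "b j + var j * h \<in> vanishing_ideal X"
        unfolding vanishing_ideal_def by blast
      have "homogenize (Suc c) (b j + var j * h) \<in> ?J"
        using mem by (rule homogenize_in_homog_ideal) (intro polys_lt_add lt h(1,2) polys_lt_var_mult)
      then show ?thesis
        by (simp only: homogenize_add[OF lt[OF h(2)] polys_lt_var_mult[OF h(1)]]
            homogenize_var_None[OF h(2)] homogenize_var_Some[OF h(1)])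
    qed
    have pure: "var (Some i) * homogenize c (b j) + var (Some j) * homogenize c (b i) \<in> ?J" for i j
    proof -
      have "eval_mpol (var i * b j + var j * b i) p = 0" if "p \<in> X" for p
      proof -
        have "eval_mpol (var i * b j + var j * b i) p
            = p i * (p j * eval_mpol h p) + p j * (p i * eval_mpol h p)"
          using that by (simp add: eq)
        also have "\<dots> = p i * (p j * eval_mpol h p) + p i * (p j * eval_mpol h p)"
          by (simp only: mult.left_commute)
        also have "\<dots> = 0" by (rule char2_add[OF char])
        finally show ?thesis .
      qed
      then have mem: "var i * b j + var j * b i \<in> vanishing_ideal X"
        unfolding vanishing_ideal_def by blast
      have "homogenize (Suc c) (var i * b j + var j * b i) \<in> ?J"
        using mem by (rule homogenize_in_homog_ideal) (intro polys_lt_add h(2) polys_lt_var_mult)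
      then show ?thesis
        by (simp only: homogenize_add[OF polys_lt_var_mult[OF h(2)] polys_lt_var_mult[OF h(2)]]
            homogenize_var_Some[OF h(2)])
    qed
    show ?thesis
      using mixed pure xy unfolding a by (cases x; cases y) (auto simp: add.commute)
  qed
  define a where "a = case_option (homogenize e f) (\<lambda>j. homogenize e (g j))"
  define a' where "a' = case_option (homogenize e' f') (\<lambda>j. homogenize e' (g' j))"
  have "\<exists>\<sigma> \<tau> F. (\<sigma> \<noteq> 0 \<or> \<tau> \<noteq> 0) \<and>
    (\<forall>x. Poly_Mapping.single 0 \<sigma> * a x + Poly_Mapping.single 0 \<tau> * a' x - var x * F \<in> ?J)"
    using cycle[OF f a_def] cycle[OF f' a'_def] rank
    by (intro penultimate_cycles_dependent[where n = "CARD('x)"]) (auto simp: card_option)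
  then obtain \<sigma> \<tau> F where "\<sigma> \<noteq> 0 \<or> \<tau> \<noteq> 0"
    and "Poly_Mapping.single 0 \<sigma> * a None + Poly_Mapping.single 0 \<tau> * a' None - var None * F \<in> ?J"
    by blast
  then show ?thesis unfolding a_def a'_def by auto
qed

text \<open>The filtration of the functions on the points by degree, with the strict bound of \<open>polys_lt\<close>.\<close>

definition code_lt :: "('m \<Rightarrow> 'x::finite \<Rightarrow> 'k::field) \<Rightarrow> nat \<Rightarrow> ('m \<Rightarrow> 'k) set" where
  "code_lt P e = {\<lambda>i. eval_mpol f (P i) | f. f \<in> polys_lt e}"

lemma eval_code_eq: "eval_code P d = code_lt P (Suc d)"
  by (simp add: eval_code_def code_lt_def polys_le_eq)

lemma code_lt_iff: "v \<in> code_lt P e \<longleftrightarrow> (\<exists>f\<in>polys_lt e. \<forall>i. v i = eval_mpol f (P i))"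
  by (auto simp: code_lt_def fun_eq_iff)

lemma code_ltI: "f \<in> polys_lt e \<Longrightarrow> (\<And>i. v i = eval_mpol f (P i)) \<Longrightarrow> v \<in> code_lt P e"
  unfolding code_lt_iff by blast

lemma code_ltE:
  assumes "v \<in> code_lt P e"
  obtains f where "f \<in> polys_lt e" "\<And>i. v i = eval_mpol f (P i)"
  using assms unfolding code_lt_iff by blast

lemma code_lt_add:
  assumes "v \<in> code_lt P e" "w \<in> code_lt P e"
  shows "(\<lambda>i. v i + w i) \<in> code_lt P e"
proof -
  obtain f g where "f \<in> polys_lt e" "\<And>i. v i = eval_mpol f (P i)"
    "g \<in> polys_lt e" "\<And>i. w i = eval_mpol g (P i)"
    using assms code_ltE by metis
  then show ?thesis by (intro code_ltI[OF polys_lt_add]) auto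
qed

lemma code_lt_mult:
  assumes "g \<in> polys_lt (Suc d)" "v \<in> code_lt P e"
  shows "(\<lambda>i. eval_mpol g (P i) * v i) \<in> code_lt P (d + e)"
proof -
  obtain f where "f \<in> polys_lt e" "\<And>i. v i = eval_mpol f (P i)"
    using assms(2) code_ltE by metis
  then show ?thesis by (intro code_ltI[OF polys_lt_mult[OF assms(1)]]) auto
qed

lemma code_lt_scale:
  assumes "v \<in> code_lt P e"
  shows "(\<lambda>i. c * v i) \<in> code_lt P e"
proof -
  have "Poly_Mapping.single 0 c \<in> polys_lt (Suc 0)"
    by (auto simp: polys_lt_iff lookup_single when_def)
  from code_lt_mult[OF this assms] show ?thesis by simp
qed

lemma code_lt_var_mult:
  assumes "v \<in> code_lt P e"
  shows "(\<lambda>i. P i j * v i) \<in> code_lt P (Suc e)"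
proof -
  obtain f where "f \<in> polys_lt e" "\<And>i. v i = eval_mpol f (P i)"
    using assms code_ltE by metis
  then show ?thesis by (intro code_ltI[OF polys_lt_var_mult[of f e j]]) auto
qed

lemma code_lt_zero: "(\<lambda>i. 0) \<in> code_lt P e"
  by (rule code_ltI[OF polys_lt_zero]) simp

lemma code_lt_sum:
  "(\<And>a. a \<in> A \<Longrightarrow> w a \<in> code_lt P e) \<Longrightarrow> (\<lambda>i. \<Sum>a\<in>A. w a i) \<in> code_lt P e"
  by (induction A rule: infinite_finite_induct) (simp_all add: code_lt_zero code_lt_add)

lemma code_lt_mono: "v \<in> code_lt P d \<Longrightarrow> d \<le> e \<Longrightarrow> v \<in> code_lt P e"
  unfolding code_lt_iff using polys_lt_mono by blast

text \<open>Such a function represents a nonzero element of degree \<open>e\<close> in the associated graded ring that is annihilated by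
all coordinates.\<close>

definition socle :: "('m \<Rightarrow> 'x::finite \<Rightarrow> 'k::field) \<Rightarrow> nat \<Rightarrow> ('m \<Rightarrow> 'k) \<Rightarrow> bool" where
  "socle P e v \<longleftrightarrow> v \<in> code_lt P (Suc e) \<and> v \<notin> code_lt P e \<and>
     (\<forall>j. (\<lambda>i. P i j * v i) \<in> code_lt P (Suc e))"

lemma socle_lift:
  assumes "socle P e v"
  obtains f g where "f \<in> polys_lt (Suc e)" "\<And>i. v i = eval_mpol f (P i)"
    "\<And>j. g j \<in> polys_lt (Suc e)" "\<And>j. var j * f - g j \<in> vanishing_ideal (range P)"
proof -
  obtain f where f: "f \<in> polys_lt (Suc e)" "\<And>i. v i = eval_mpol f (P i)"
    using assms unfolding socle_def code_lt_iff by blast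
  have "\<exists>g. g \<in> polys_lt (Suc e) \<and> (\<forall>i. P i j * v i = eval_mpol g (P i))" for j
    using assms unfolding socle_def code_lt_iff by blast
  then obtain g where "\<And>j. g j \<in> polys_lt (Suc e)" "\<And>j i. P i j * v i = eval_mpol (g j) (P i)"
    by metis
  then show thesis using f by (intro that[of f g]) (auto simp: vanishing_ideal_def)
qed

lemma dehom_part_var_None_lt: "dehom_part e (var None * F) \<in> polys_lt e"
  by (cases e) (simp_all add: dehom_part_0_var dehom_part_var_None)

lemma dehom_part_diff: "dehom_part e (F - G) = dehom_part e F - dehom_part e G"
  by (rule poly_mapping_eqI) (simp add: lookup_dehom_part lookup_minus)

text \<open>Taking the component of degree \<open>e\<close> in \<open>gorenstein_socle_dependent\<close> and evaluating at the points turns the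
multiple of \<open>u\<close> into a function of degree less than \<open>e\<close>. As neither function is of smaller degree, both
coefficients of the combination are nonzero and the degrees agree.\<close>

lemma gorenstein_socle_unique:
  fixes P :: "'m \<Rightarrow> 'x::finite \<Rightarrow> 'k::field"
  assumes char: "CHAR('k) = 2" and gor: "gorenstein (vanishing_ideal (range P))"
    and v: "socle P e v" and v': "socle P e' v'"
  shows "e = e' \<and> (\<exists>c. c \<noteq> 0 \<and> (\<lambda>i. v' i - c * v i) \<in> code_lt P e)"
proof -
  obtain f g where f: "f \<in> polys_lt (Suc e)" "\<And>j. g j \<in> polys_lt (Suc e)"
      "\<And>j. var j * f - g j \<in> vanishing_ideal (range P)" and vf: "\<And>i. v i = eval_mpol f (P i)"
    using v by (rule socle_lift) blast
  obtain f' g' where f': "f' \<in> polys_lt (Suc e')" "\<And>j. g' j \<in> polys_lt (Suc e')"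
      "\<And>j. var j * f' - g' j \<in> vanishing_ideal (range P)" and vf': "\<And>i. v' i = eval_mpol f' (P i)"
    using v' by (rule socle_lift) blast
  obtain \<sigma> \<tau> F where nz: "\<sigma> \<noteq> 0 \<or> \<tau> \<noteq> 0"
    and "Poly_Mapping.single 0 \<sigma> * homogenize e f + Poly_Mapping.single 0 \<tau> * homogenize e' f' - var None * F
      \<in> homog_ideal (vanishing_ideal (range P))"
    using gorenstein_socle_dependent[OF char gor f f'] by blast
  then have mem: "dehom_part d (Poly_Mapping.single 0 \<sigma> * homogenize e f
      + Poly_Mapping.single 0 \<tau> * homogenize e' f' - var None * F) \<in> vanishing_ideal (range P)" for d
    unfolding homog_ideal_iff by blast
  have "\<sigma> * (if d = e then v i else 0) + \<tau> * (if d = e' then v' i else 0)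
      = eval_mpol (dehom_part d (var None * F)) (P i)" for d i
    using mem[of d] unfolding dehom_part_diff dehom_part_add dehom_part_const_mult
    by (cases "d = e"; cases "d = e'")
      (simp_all add: vanishing_ideal_def dehom_part_homogenize f(1) f'(1) vf vf')
  then have rel: "(\<lambda>i. \<sigma> * (if d = e then v i else 0) + \<tau> * (if d = e' then v' i else 0)) \<in> code_lt P d" for d
    by (intro code_ltI[OF dehom_part_var_None_lt])
  have cancel: "w \<in> code_lt P d" if "(\<lambda>i. c * w i) \<in> code_lt P d" "c \<noteq> 0" for c d and w :: "'m \<Rightarrow> 'k"
    using code_lt_scale[OF that(1), of "inverse c"] that(2) by (simp add: mult.assoc[symmetric])
  have notin: "v \<notin> code_lt P e" "v' \<notin> code_lt P e'" using v v' by (auto simp: socle_def)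
  have "e = e'"
  proof (rule ccontr)
    assume ne: "e \<noteq> e'"
    have "(\<lambda>i. \<sigma> * v i) \<in> code_lt P e" using rel[of e] ne by simp
    moreover have "(\<lambda>i. \<tau> * v' i) \<in> code_lt P e'" using rel[of e'] ne by simp
    ultimately have "\<sigma> = 0" "\<tau> = 0"
      using cancel[of \<sigma> v e] cancel[of \<tau> v' e'] notin by blast+
    with nz show False by simp
  qed
  have comb: "(\<lambda>i. \<sigma> * v i + \<tau> * v' i) \<in> code_lt P e" using rel[of e] \<open>e = e'\<close> by simp
  have "\<sigma> \<noteq> 0" using comb cancel[of \<tau> v' e] notin(2) nz \<open>e = e'\<close> by auto
  moreover have "\<tau> \<noteq> 0" using comb cancel[of \<sigma> v e] notin(1) nz by auto
  moreover have "(\<lambda>i. v' i - (- \<sigma> / \<tau>) * v i) \<in> code_lt P e"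
    using code_lt_scale[OF comb, of "inverse \<tau>"] \<open>\<tau> \<noteq> 0\<close>
    by (simp add: field_simps)
  ultimately show ?thesis using \<open>e = e'\<close> by (intro conjI exI[of _ "- \<sigma> / \<tau>"]) auto
qed


section \<open>Hilbert function and regularity index\<close>

lemma polys_le_finite: "finite (polys_le d :: ('x::finite, 'k::{field,finite}) mpol set)"
proof (rule finite_imageD)
  let ?M = "{m :: 'x mon. mdeg m \<le> d}"
  let ?r = "\<lambda>f :: ('x, 'k) mpol. restrict (Poly_Mapping.lookup f) ?M"
  show "finite (?r ` polys_le d)"
    by (rule finite_subset[of _ "?M \<rightarrow>\<^sub>E UNIV"]) (auto intro: finite_PiE finite_mdeg_le split: if_splits)
  show "inj_on ?r (polys_le d)"
  proof (rule inj_onI)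
    fix f g :: "('x, 'k) mpol"
    assume f: "f \<in> polys_le d" and g: "g \<in> polys_le d" and eq: "?r f = ?r g"
    show "f = g"
    proof (rule poly_mapping_eqI)
      fix m
      show "Poly_Mapping.lookup f m = Poly_Mapping.lookup g m"
        using f g fun_cong[OF eq, of m] unfolding polys_le_eq polys_lt_iff
        by (cases "mdeg m \<le> d") (auto simp: not_le)
    qed
  qed
qed

lemma eval_pscale [simp]: "eval_mpol (pscale (c :: 'k::field) f) p = c * eval_mpol f p"
  by (simp add: pscale_def)

lemma pscale_polys_le: "f \<in> polys_le d \<Longrightarrow> pscale (c :: 'k::field) f \<in> polys_le d"
  unfolding pscale_def polys_le_eq by (rule polys_lt_const_mult)

lemma polys_le_diff_mem:
  assumes "v \<in> polys_le d" "w \<in> polys_le d"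
  shows "v - w \<in> vanishing_ideal (range P) \<inter> polys_le d
    \<longleftrightarrow> (\<forall>i. eval_mpol v (P i) = eval_mpol w (P i))"
  using assms by (auto simp: vanishing_ideal_def polys_le_eq polys_lt_iff lookup_minus)

lemma hilbert_basis_combination:
  assumes "B \<subseteq> polys_le d"
  shows "(\<Sum>b\<in>B. pscale (c b :: 'k::field) b) \<in> polys_le d"
  using assms unfolding polys_le_eq
  by (intro polys_lt_sum) (auto simp: polys_le_eq[symmetric] intro: pscale_polys_le)

text \<open>A spanning set of least cardinality is independent: a member with a nonzero coefficient in a relation could be
removed.\<close>

lemma hilbert_basis_exists:
  fixes P :: "'m \<Rightarrow> 'x::finite \<Rightarrow> 'k::{field,finite}"
  shows "\<exists>B. quotient_basis pscale (polys_le d) (vanishing_ideal (range P) \<inter> polys_le d) B"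
proof -
  let ?V = "polys_le d :: ('x, 'k) mpol set"
  define spans where "spans B \<longleftrightarrow> B \<subseteq> ?V \<and>
      (\<forall>v\<in>?V. \<exists>c. \<forall>i. eval_mpol v (P i) = (\<Sum>b\<in>B. c b * eval_mpol b (P i)))" for B
  \<comment> \<open>Over a finite field the space of polynomials of bounded degree is finite and spans itself.\<close>
  have "spans ?V"
    unfolding spans_def
  proof (intro conjI ballI subset_refl)
    fix v :: "('x, 'k) mpol" assume "v \<in> ?V"
    moreover have "finite ?V" by (rule polys_le_finite)
    ultimately show "\<exists>c. \<forall>i. eval_mpol v (P i) = (\<Sum>b\<in>?V. c b * eval_mpol b (P i))"
      by (intro exI[of _ "\<lambda>b. if b = v then 1 else 0"]) (simp add: if_distrib[where f = "\<lambda>x. x * _"] cong: if_cong)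
  qed
  then obtain B where B: "spans B" and least: "\<And>B'. spans B' \<Longrightarrow> card B \<le> card B'"
    using ex_has_least_nat[of spans ?V card] by blast
  have sub: "B \<subseteq> ?V" using B by (simp add: spans_def)
  then have fin: "finite B" using polys_le_finite finite_subset by blast
  have independent: "c b0 = 0"
    if rel: "\<And>i. (\<Sum>b\<in>B. c b * eval_mpol b (P i)) = 0" and b0: "b0 \<in> B" for c b0
  proof (rule ccontr)
    assume nz: "c b0 \<noteq> 0"
    have "spans (B - {b0})"
      unfolding spans_def
    proof (intro conjI ballI)
      fix v :: "('x, 'k) mpol" assume "v \<in> ?V"
      then obtain a where a: "\<And>i. eval_mpol v (P i) = (\<Sum>b\<in>B. a b * eval_mpol b (P i))"
        using B unfolding spans_def by blast
      define a' where "a' b = a b - a b0 / c b0 * c b" for b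
      have "eval_mpol v (P i) = (\<Sum>b\<in>B - {b0}. a' b * eval_mpol b (P i))" for i
      proof -
        have "(\<Sum>b\<in>B. a' b * eval_mpol b (P i))
            = eval_mpol v (P i) - a b0 / c b0 * (\<Sum>b\<in>B. c b * eval_mpol b (P i))"
          by (simp only: a a'_def left_diff_distrib sum_subtractf sum_distrib_left mult.assoc)
        moreover have "a' b0 = 0" using nz by (simp add: a'_def)
        ultimately show ?thesis
          using rel[of i] sum.remove[OF fin b0, of "\<lambda>b. a' b * eval_mpol b (P i)"] by simp
      qed
      then show "\<exists>a. \<forall>i. eval_mpol v (P i) = (\<Sum>b\<in>B - {b0}. a b * eval_mpol b (P i))" by blast
    next
      show "B - {b0} \<subseteq> ?V" using sub by blast
    qed
    then have "card B \<le> card (B - {b0})" by (rule least)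
    moreover have "card (B - {b0}) < card B" using fin b0 by (rule card_Diff1_less)
    ultimately show False by simp
  qed
  have comb: "v - (\<Sum>b\<in>B. pscale (c b) b) \<in> vanishing_ideal (range P) \<inter> ?V
      \<longleftrightarrow> (\<forall>i. eval_mpol v (P i) = (\<Sum>b\<in>B. c b * eval_mpol b (P i)))" if "v \<in> ?V" for v c
    using polys_le_diff_mem[OF that hilbert_basis_combination[OF sub, of c], of P] by simp
  have unique: "\<exists>!c. c \<in> B \<rightarrow>\<^sub>E UNIV \<and> v - (\<Sum>b\<in>B. pscale (c b) b) \<in> vanishing_ideal (range P) \<inter> ?V"
    if v: "v \<in> ?V" for v
  proof -
    obtain a where a: "\<And>i. eval_mpol v (P i) = (\<Sum>b\<in>B. a b * eval_mpol b (P i))"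
      using B v unfolding spans_def by blast
    show ?thesis
      unfolding comb[OF v]
    proof (rule ex1I[of _ "restrict a B"])
      show "restrict a B \<in> B \<rightarrow>\<^sub>E UNIV \<and> (\<forall>i. eval_mpol v (P i) = (\<Sum>b\<in>B. restrict a B b * eval_mpol b (P i)))"
        by (simp add: a)
      fix c assume c: "c \<in> B \<rightarrow>\<^sub>E UNIV \<and> (\<forall>i. eval_mpol v (P i) = (\<Sum>b\<in>B. c b * eval_mpol b (P i)))"
      have "(\<Sum>b\<in>B. (c b - a b) * eval_mpol b (P i)) = 0" for i
      proof -
        have "(\<Sum>b\<in>B. c b * eval_mpol b (P i)) = (\<Sum>b\<in>B. a b * eval_mpol b (P i))"
          using c a by metis
        then show ?thesis by (simp add: left_diff_distrib sum_subtractf)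
      qed
      from independent[of "\<lambda>b. c b - a b", OF this] have "c b = a b" if "b \<in> B" for b
        using that by simp
      then show "c = restrict a B"
        using c by (intro ext) (auto simp: restrict_def PiE_def extensional_def)
    qed
  qed
  have "quotient_basis pscale ?V (vanishing_ideal (range P) \<inter> ?V) B"
    unfolding quotient_basis_def by (intro conjI ballI fin sub unique)
  then show ?thesis by (rule exI)
qed

text \<open>Coordinates with respect to a basis of the quotient enumerate the value vectors. Over a finite field, counting them
determines the size of the basis.\<close>

lemma card_eval_code:
  fixes P :: "'m::finite \<Rightarrow> 'x::finite \<Rightarrow> 'k::{field,finite}"
  assumes "quotient_basis pscale (polys_le d) (vanishing_ideal (range P) \<inter> polys_le d) B"
  shows "card (eval_code P d) = CARD('k) ^ card B"
proof -
  let ?V = "polys_le d :: ('x, 'k) mpol set"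
  have fin: "finite B" and sub: "B \<subseteq> ?V"
    and unique: "\<And>v. v \<in> ?V \<Longrightarrow> \<exists>!c. c \<in> B \<rightarrow>\<^sub>E UNIV \<and>
      v - (\<Sum>b\<in>B. pscale (c b) b) \<in> vanishing_ideal (range P) \<inter> ?V"
    using assms unfolding quotient_basis_def by blast+
  let ?L = "\<lambda>c. \<Sum>b\<in>B. pscale (c b) b"
  have L: "?L c \<in> ?V" for c by (rule hilbert_basis_combination[OF sub])
  have "bij_betw (\<lambda>c i. eval_mpol (?L c) (P i)) (B \<rightarrow>\<^sub>E UNIV) (eval_code P d)"
    unfolding bij_betw_def
  proof
    show "inj_on (\<lambda>c i. eval_mpol (?L c) (P i)) (B \<rightarrow>\<^sub>E UNIV)"
    proof (rule inj_onI)
      fix c c' :: "('x, 'k) mpol \<Rightarrow> 'k"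
      assume c: "c \<in> B \<rightarrow>\<^sub>E UNIV" "c' \<in> B \<rightarrow>\<^sub>E UNIV"
        and eq: "(\<lambda>i. eval_mpol (?L c) (P i)) = (\<lambda>i. eval_mpol (?L c') (P i))"
      have "?L c - ?L c \<in> vanishing_ideal (range P) \<inter> ?V" "?L c - ?L c' \<in> vanishing_ideal (range P) \<inter> ?V"
        unfolding polys_le_diff_mem[OF L L] using fun_cong[OF eq] by simp_all
      then show "c = c'" using unique[OF L, of c] c by blast
    qed
    show "(\<lambda>c i. eval_mpol (?L c) (P i)) ` (B \<rightarrow>\<^sub>E UNIV) = eval_code P d"
    proof (intro equalityI subsetI)
      fix w assume "w \<in> (\<lambda>c i. eval_mpol (?L c) (P i)) ` (B \<rightarrow>\<^sub>E UNIV)"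
      then show "w \<in> eval_code P d" using L unfolding eval_code_def by blast
    next
      fix w assume "w \<in> eval_code P d"
      then obtain v where v: "v \<in> ?V" "w = (\<lambda>i. eval_mpol v (P i))" unfolding eval_code_def by blast
      then obtain c where "c \<in> B \<rightarrow>\<^sub>E UNIV" "v - ?L c \<in> vanishing_ideal (range P) \<inter> ?V"
        using unique by blast
      then show "w \<in> (\<lambda>c i. eval_mpol (?L c) (P i)) ` (B \<rightarrow>\<^sub>E UNIV)"
        unfolding polys_le_diff_mem[OF v(1) L] v(2) by (intro image_eqI[of _ _ c]) simp_all
    qed
  qed
  then have "card (eval_code P d) = card (B \<rightarrow>\<^sub>E (UNIV :: 'k set))" by (rule bij_betw_same_card[symmetric])
  then show ?thesis using fin by (simp add: card_PiE)
qed

lemma affine_hilbert_full_iff: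
  fixes P :: "'m::finite \<Rightarrow> 'x::finite \<Rightarrow> 'k::{field,finite}"
  shows "affine_hilbert (vanishing_ideal (range P)) d = CARD('m) \<longleftrightarrow> code_lt P (Suc d) = UNIV"
proof -
  let ?Q = "quotient_basis pscale (polys_le d) (vanishing_ideal (range P) \<inter> polys_le d)"
  have q: "1 < CARD('k)"
    using card_mono[of UNIV "{0, 1 :: 'k}"] by simp
  obtain B where B: "?Q B" using hilbert_basis_exists by blast
  have same: "card B' = card B" if "?Q B'" for B'
    using card_eval_code[OF that] card_eval_code[OF B] q by simp
  have "affine_hilbert (vanishing_ideal (range P)) d = card B"
    unfolding affine_hilbert_def quotient_dim_def
  proof (rule the_equality)
    show "\<exists>B'. ?Q B' \<and> card B' = card B" using B by blast
    show "n = card B" if "\<exists>B. ?Q B \<and> card B = n" for n using that same by blast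
  qed
  then have "affine_hilbert (vanishing_ideal (range P)) d = CARD('m)
      \<longleftrightarrow> card (eval_code P d) = card (UNIV :: ('m \<Rightarrow> 'k) set)"
    using card_eval_code[OF B] q by (simp add: card_fun)
  also have "\<dots> \<longleftrightarrow> eval_code P d = UNIV"
    using card_subset_eq[of "UNIV :: ('m \<Rightarrow> 'k) set" "eval_code P d"] by auto
  finally show ?thesis by (simp add: eval_code_eq)
qed

lemma separating_poly:
  fixes p :: "'x::finite \<Rightarrow> 'k::field"
  assumes "finite Y" "p \<notin> Y"
  shows "\<exists>f. eval_mpol f p = 1 \<and> (\<forall>q\<in>Y. eval_mpol f q = 0)"
  using assms
proof induction
  case empty
  then show ?case by (intro exI[of _ 1]) simp
next
  case (insert q Y)
  then obtain f where f: "eval_mpol f p = 1" "\<forall>q\<in>Y. eval_mpol f q = 0" by auto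
  obtain j where j: "p j \<noteq> q j" using insert.prems by auto
  let ?g = "Poly_Mapping.single 0 (inverse (p j - q j)) * (var j - Poly_Mapping.single 0 (q j))"
  show ?case using f j by (intro exI[of _ "?g * f"]) auto
qed

lemma code_lt_full_exists:
  fixes P :: "'m::finite \<Rightarrow> 'x::finite \<Rightarrow> 'k::field"
  assumes "inj P"
  shows "\<exists>N. code_lt P N = UNIV"
proof -
  have "\<exists>f. eval_mpol f (P i) = 1 \<and> (\<forall>q\<in>P ` (- {i}). eval_mpol f q = 0)" for i
    using assms by (intro separating_poly) (auto dest: injD)
  then obtain f where f: "\<And>i. eval_mpol (f i) (P i) = 1"
      "\<And>i j. j \<noteq> i \<Longrightarrow> eval_mpol (f i) (P j) = 0"
    by (metis ComplI imageI singletonD)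
  have "\<exists>e. f i \<in> polys_lt e" for i by (rule polys_lt_exists)
  then obtain e where e: "\<And>i. f i \<in> polys_lt (e i)" by metis
  \<comment> \<open>There are finitely many points, so the interpolating polynomials have a common degree bound.\<close>
  define N where "N = Max (range e)"
  have fN: "f i \<in> polys_lt N" for i
    using e by (rule polys_lt_mono) (simp add: N_def)
  have "v \<in> code_lt P N" for v
  proof (rule code_ltI)
    show "(\<Sum>i\<in>UNIV. Poly_Mapping.single 0 (v i) * f i) \<in> polys_lt N"
      by (intro polys_lt_sum polys_lt_const_mult fN)
    have "v j * eval_mpol (f j) (P i) = (if j = i then v i else 0)" for i j
      using f(1)[of i] f(2)[of i j] by auto
    then show "v i = eval_mpol (\<Sum>i\<in>UNIV. Poly_Mapping.single 0 (v i) * f i) (P i)" for i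
      by simp
  qed
  then show ?thesis by blast
qed

text \<open>Once the codes fill the whole space they continue to do so, hence the regularity index is the first degree in which
every function is the value vector of a polynomial.\<close>

lemma regularity_index_code:
  fixes P :: "'m::finite \<Rightarrow> 'x::finite \<Rightarrow> 'k::{field,finite}"
  assumes "inj P"
  shows "code_lt P (Suc (regularity_index (range P))) = UNIV"
    and "0 < regularity_index (range P) \<Longrightarrow> code_lt P (regularity_index (range P)) \<noteq> UNIV"
proof -
  define full where "full l \<longleftrightarrow> (\<forall>d\<ge>l. code_lt P (Suc d) = UNIV)" for l
  have card: "card (range P) = CARD('m)" using assms by (simp add: card_image)
  have mono: "code_lt P e = UNIV" if "code_lt P d = UNIV" "d \<le> e" for d e
    using that code_lt_mono[of _ P d e] by blast
  have r: "regularity_index (range P) = (LEAST l. full l)"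
    unfolding regularity_index_def card affine_hilbert_full_iff full_def ..
  obtain N where "code_lt P N = UNIV" using code_lt_full_exists[OF assms] by blast
  then have "full N" unfolding full_def using mono by (meson le_SucI)
  then have "full (regularity_index (range P))" unfolding r by (rule LeastI)
  then show "code_lt P (Suc (regularity_index (range P))) = UNIV" by (simp add: full_def)
  show "code_lt P (regularity_index (range P)) \<noteq> UNIV" if pos: "0 < regularity_index (range P)"
  proof
    assume top: "code_lt P (regularity_index (range P)) = UNIV"
    have "full (regularity_index (range P) - 1)"
      unfolding full_def
    proof (intro allI impI)
      fix d assume "regularity_index (range P) - 1 \<le> d"
      then show "code_lt P (Suc d) = UNIV" using pos by (intro mono[OF top]) simp
    qed
    then have "regularity_index (range P) \<le> regularity_index (range P) - 1"
      unfolding r by (rule Least_le)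
    then show False using pos by simp
  qed
qed


section \<open>Normal forms with respect to a graded order\<close>

lemma graded_order_mdeg:
  assumes "graded_monomial_order prec" "prec a b"
  shows "mdeg a \<le> mdeg b"
proof (rule ccontr)
  assume "\<not> mdeg a \<le> mdeg b"
  then have "prec b a" using assms(1) by (simp add: graded_monomial_order_def)
  then have "prec a a" using assms by (meson graded_monomial_order_def transpD)
  then show False using assms(1) by (meson graded_monomial_order_def irreflpD)
qed

lemma lead_mon_eqI:
  assumes "graded_monomial_order prec" "m \<in> Poly_Mapping.keys f"
    and "\<And>n. n \<in> Poly_Mapping.keys f \<Longrightarrow> n \<noteq> m \<Longrightarrow> prec n m"
  shows "lead_mon prec f = m"
  unfolding lead_mon_def
proof (rule the_equality)
  show "m \<in> Poly_Mapping.keys f \<and> (\<forall>n\<in>Poly_Mapping.keys f. n \<noteq> m \<longrightarrow> prec n m)"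
    using assms by blast
  fix m' assume m': "m' \<in> Poly_Mapping.keys f \<and> (\<forall>n\<in>Poly_Mapping.keys f. n \<noteq> m' \<longrightarrow> prec n m')"
  show "m' = m"
  proof (rule ccontr)
    assume "m' \<noteq> m"
    then have "prec m m'" "prec m' m" using m' assms by metis+
    then have "prec m m" using assms(1) by (meson graded_monomial_order_def transpD)
    then show False using assms(1) by (meson graded_monomial_order_def irreflpD)
  qed
qed

lemma lead_mon:
  assumes order: "graded_monomial_order prec" and "f \<noteq> 0"
  shows "lead_mon prec f \<in> Poly_Mapping.keys f"
    and "n \<in> Poly_Mapping.keys f \<Longrightarrow> n \<noteq> lead_mon prec f \<Longrightarrow> prec n (lead_mon prec f)"
proof -
  have "\<exists>m\<in>A. \<forall>n\<in>A. n \<noteq> m \<longrightarrow> prec n m" if "finite A" "A \<noteq> {}" for A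
    using that
  proof (induction rule: finite_ne_induct)
    case (insert a A)
    then obtain m where m: "m \<in> A" "\<forall>n\<in>A. n \<noteq> m \<longrightarrow> prec n m" by blast
    show ?case
    proof (cases "prec a m")
      case True
      then show ?thesis using m by (intro bexI[of _ m]) auto
    next
      case False
      then have "prec m a"
        using order insert.hyps m(1) by (metis graded_monomial_order_def totalpD)
      then show ?thesis
        using order m by (intro bexI[of _ a]) (auto, metis graded_monomial_order_def transpD)
    qed
  qed simp
  then obtain m where m: "m \<in> Poly_Mapping.keys f"
      "\<And>n. n \<in> Poly_Mapping.keys f \<Longrightarrow> n \<noteq> m \<Longrightarrow> prec n m"
    using assms(2) by (metis finite_keys keys_eq_empty)
  then have "lead_mon prec f = m" by (rule lead_mon_eqI[OF order])
  then show "lead_mon prec f \<in> Poly_Mapping.keys f"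
    and "n \<in> Poly_Mapping.keys f \<Longrightarrow> n \<noteq> lead_mon prec f \<Longrightarrow> prec n (lead_mon prec f)"
    using m by auto
qed

text \<open>The generators are monomials, and multiples and sums of them involve only monomials divisible by one of them.\<close>

lemma initial_ideal_monomial:
  fixes F :: "('x, 'k::field) mpol"
  assumes "F \<in> initial_ideal prec I" "m \<in> Poly_Mapping.keys F"
  shows "\<exists>f\<in>I. f \<noteq> 0 \<and> (\<exists>n. m = lead_mon prec f + n)"
  using assms unfolding initial_ideal_def
proof (induction arbitrary: m rule: ideal_gen_induct)
  case (step c x y)
  then obtain f where f: "f \<in> I" "f \<noteq> 0" "x = Poly_Mapping.single (lead_mon prec f) 1" by blast
  have "m \<in> Poly_Mapping.keys (c * x) \<or> m \<in> Poly_Mapping.keys y"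
    using step.prems keys_add[of "c * x" y] by blast
  then show ?case
  proof
    assume "m \<in> Poly_Mapping.keys (c * x)"
    then obtain n where "m = lead_mon prec f + n"
      unfolding f(3) mult.commute[of c] by (subst (asm) keys_single_mult) auto
    then show ?thesis using f by blast
  next
    assume "m \<in> Poly_Mapping.keys y"
    then show ?thesis by (rule step.IH)
  qed
qed simp

lemma module_pscale: "Modules.module (pscale :: 'k::field \<Rightarrow> ('x, 'k) mpol \<Rightarrow> ('x, 'k) mpol)"
  using vector_space_pscale by (simp add: module_iff_vector_space)

lemma std_span_iff:
  fixes f :: "('x, 'k::field) mpol"
  shows "f \<in> std_span prec I \<longleftrightarrow> Poly_Mapping.keys f \<subseteq> std_monomials prec I"
proof
  assume "f \<in> std_span prec I"
  then show "Poly_Mapping.keys f \<subseteq> std_monomials prec I"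
    unfolding std_span_def
  proof (induction rule: Modules.module.span_induct_alt[OF module_pscale, consumes 1, case_names zero step])
    case (step c x y)
    then obtain m where m: "m \<in> std_monomials prec I" "x = Poly_Mapping.single m 1" by blast
    have "Poly_Mapping.keys (pscale c x) \<subseteq> {m}"
      unfolding m pscale_def by (cases "c = 0") (simp_all add: mult_single)
    then show ?case using m(1) step.IH keys_add[of "pscale c x" y] by blast
  qed simp
next
  assume keys: "Poly_Mapping.keys f \<subseteq> std_monomials prec I"
  have "f = (\<Sum>m\<in>Poly_Mapping.keys f. pscale (Poly_Mapping.lookup f m) (Poly_Mapping.single m 1))"
    by (subst poly_sum_monomials) (simp add: pscale_def mult_single)
  also have "\<dots> \<in> std_span prec I"
    unfolding std_span_def using keys
    by (intro Modules.module.span_sum[OF module_pscale] Modules.module.span_scale[OF module_pscale]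
        Modules.module.span_base[OF module_pscale]) blast
  finally show "f \<in> std_span prec I" .
qed

text \<open>The leading monomial of a nonzero element of the ideal is nonstandard by definition.\<close>

lemma std_span_eq_zero:
  fixes f :: "('x::finite, 'k::field) mpol"
  assumes order: "graded_monomial_order prec"
    and "Poly_Mapping.keys f \<subseteq> std_monomials prec I" "f \<in> I"
  shows "f = 0"
proof (rule ccontr)
  assume "f \<noteq> 0"
  then have "Poly_Mapping.single (lead_mon prec f) 1 \<in> initial_ideal prec I"
    unfolding initial_ideal_def using assms(3) by (intro ideal_gen_base) blast
  then show False
    using lead_mon(1)[OF order \<open>f \<noteq> 0\<close>] assms(2) unfolding std_monomials_def by blast
qed

lemma normal_form_combine:
  fixes f :: "('x::finite, 'k::field) mpol"
  assumes "\<And>n. n \<in> Poly_Mapping.keys f \<Longrightarrow> \<exists>h. Poly_Mapping.keys h \<subseteq> D \<and> h \<in> polys_lt e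
    \<and> Poly_Mapping.single n 1 - h \<in> vanishing_ideal X"
  shows "\<exists>h. Poly_Mapping.keys h \<subseteq> D \<and> h \<in> polys_lt e \<and> f - h \<in> vanishing_ideal X"
proof -
  obtain H where H: "\<And>n. n \<in> Poly_Mapping.keys f \<Longrightarrow> Poly_Mapping.keys (H n) \<subseteq> D"
      "\<And>n. n \<in> Poly_Mapping.keys f \<Longrightarrow> H n \<in> polys_lt e"
      "\<And>n. n \<in> Poly_Mapping.keys f \<Longrightarrow> Poly_Mapping.single n 1 - H n \<in> vanishing_ideal X"
    using assms by metis
  define h where "h = (\<Sum>n\<in>Poly_Mapping.keys f. Poly_Mapping.single 0 (Poly_Mapping.lookup f n) * H n)"
  have "Poly_Mapping.keys h \<subseteq> D"
  proof
    fix q assume "q \<in> Poly_Mapping.keys h"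
    then have "(\<Sum>n\<in>Poly_Mapping.keys f. Poly_Mapping.lookup f n * Poly_Mapping.lookup (H n) q) \<noteq> 0"
      by (simp add: h_def in_keys_iff lookup_sum)
    then obtain n where "n \<in> Poly_Mapping.keys f" "Poly_Mapping.lookup (H n) q \<noteq> 0"
      by (metis (no_types, lifting) mult_zero_right sum.neutral)
    then show "q \<in> D" using H(1)[of n] by (auto simp: in_keys_iff)
  qed
  moreover have "h \<in> polys_lt e"
    unfolding h_def by (intro polys_lt_sum polys_lt_const_mult H(2))
  moreover have "eval_mpol f p = eval_mpol h p" if "p \<in> X" for p
  proof -
    have "eval_mpol f p = (\<Sum>n\<in>Poly_Mapping.keys f. Poly_Mapping.lookup f n * eval_mpol (Poly_Mapping.single n 1) p)"
      by (simp add: eval_mpol_def[of f] eval_single)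
    also have "\<dots> = eval_mpol h p"
      unfolding h_def eval_sum eval_const_mult
      using H(3) that by (intro sum.cong) (auto simp: vanishing_ideal_def)
    finally show ?thesis .
  qed
  ultimately show ?thesis by (auto simp: vanishing_ideal_def)
qed

text \<open>Division with remainder, by induction along the order: a nonstandard monomial is a multiple of a leading monomial of
the ideal and can be replaced by smaller monomials. For a graded order these have no larger degree, and there are
only finitely many of them, which bounds the induction.\<close>

lemma normal_form_monomial:
  fixes X :: "('x::finite \<Rightarrow> 'k::field) set"
  assumes order: "graded_monomial_order prec"
  shows "\<exists>h. Poly_Mapping.keys h \<subseteq> std_monomials prec (vanishing_ideal X) \<and> h \<in> polys_lt (Suc (mdeg m))
    \<and> Poly_Mapping.single m 1 - h \<in> vanishing_ideal X"
proof (induction "card {n. prec n m}" arbitrary: m rule: less_induct)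
  case less
  let ?I = "vanishing_ideal X"
  let ?\<Delta> = "std_monomials prec ?I"
  show ?case
  proof (cases "m \<in> ?\<Delta>")
    case True
    then show ?thesis
      by (intro exI[of _ "Poly_Mapping.single m 1"]) (simp add: polys_lt_def vanishing_ideal_def)
  next
    case False
    then have "Poly_Mapping.single m 1 \<in> initial_ideal prec ?I" by (simp add: std_monomials_def)
    then obtain f c where f: "f \<in> ?I" "f \<noteq> 0" "m = lead_mon prec f + c"
      using initial_ideal_monomial[of _ prec ?I m] by fastforce
    let ?a = "Poly_Mapping.lookup f (lead_mon prec f)"
    have a: "?a \<noteq> 0" using lead_mon(1)[OF order f(2)] by (simp add: in_keys_iff)
    \<comment> \<open>The multiple of \<open>f\<close> with leading term \<open>m\<close> and coefficient 1; its remaining terms are smaller than \<open>m\<close>.\<close>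
    define g where "g = Poly_Mapping.single c (inverse ?a) * f"
    have gm: "Poly_Mapping.lookup g m = 1"
      unfolding g_def f(3) add.commute[of _ c] using a by simp
    define k where "k = Poly_Mapping.single m 1 - g"
    have k_I: "Poly_Mapping.single m 1 - k \<in> ?I"
      using f(1) by (simp add: k_def g_def vanishing_ideal_def)
    have k_prec: "prec n m" if "n \<in> Poly_Mapping.keys k" for n
    proof -
      have "Poly_Mapping.lookup k n \<noteq> 0" using that by (simp add: in_keys_iff)
      then have "n \<noteq> m" "n \<in> Poly_Mapping.keys g"
        using gm by (auto simp: k_def lookup_minus lookup_single in_keys_iff when_def split: if_splits)
      then obtain n' where n': "n = c + n'" "n' \<in> Poly_Mapping.keys f"
        unfolding g_def using a by (subst (asm) keys_single_mult) auto
      then have "prec n' (lead_mon prec f)"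
        using lead_mon(2)[OF order f(2)] \<open>n \<noteq> m\<close> f(3) by (auto simp: add.commute)
      then show ?thesis
        using order unfolding n'(1) f(3) add.commute[of c] graded_monomial_order_def by blast
    qed
    have "\<exists>h. Poly_Mapping.keys h \<subseteq> ?\<Delta> \<and> h \<in> polys_lt (Suc (mdeg m)) \<and> k - h \<in> ?I"
    proof (rule normal_form_combine)
      fix n assume n: "n \<in> Poly_Mapping.keys k"
      have "finite {n. prec n m}"
        using graded_order_mdeg[OF order] by (intro finite_subset[OF _ finite_mdeg_le[of "mdeg m"]]) blast
      moreover have "{n'. prec n' n} \<subset> {n. prec n m}"
        using k_prec[OF n] order unfolding graded_monomial_order_def
        by (auto dest: transpD irreflpD)
      ultimately have "card {n'. prec n' n} < card {n. prec n m}" by (rule psubset_card_mono)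
      from less.hyps[OF this] show "\<exists>h. Poly_Mapping.keys h \<subseteq> ?\<Delta> \<and> h \<in> polys_lt (Suc (mdeg m))
          \<and> Poly_Mapping.single n 1 - h \<in> ?I"
        using graded_order_mdeg[OF order k_prec[OF n]] polys_lt_mono Suc_le_mono by blast
    qed
    then obtain h where h: "Poly_Mapping.keys h \<subseteq> ?\<Delta>" "h \<in> polys_lt (Suc (mdeg m))" "k - h \<in> ?I"
      by blast
    have "Poly_Mapping.single m 1 - h \<in> ?I"
      using vanishing_add[OF k_I h(3)] by simp
    with h(1,2) show ?thesis by blast
  qed
qed

lemma normal_form:
  fixes X :: "('x::finite \<Rightarrow> 'k::field) set"
  assumes order: "graded_monomial_order prec" and f: "f \<in> polys_lt e"
  shows "\<exists>h. Poly_Mapping.keys h \<subseteq> std_monomials prec (vanishing_ideal X) \<and> h \<in> polys_lt e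
    \<and> f - h \<in> vanishing_ideal X"
proof (rule normal_form_combine)
  fix n assume "n \<in> Poly_Mapping.keys f"
  then have "Suc (mdeg n) \<le> e" using f by (auto simp: polys_lt_def)
  then show "\<exists>h. Poly_Mapping.keys h \<subseteq> std_monomials prec (vanishing_ideal X) \<and> h \<in> polys_lt e
      \<and> Poly_Mapping.single n 1 - h \<in> vanishing_ideal X"
    using normal_form_monomial[OF order, of X n] polys_lt_mono by blast
qed

text \<open>An interpolating polynomial exists by hypothesis; its normal form has the required values, and two normal forms with
the same values differ by an element of the ideal in the span of the standard monomials.\<close>

lemma std_indicator:
  fixes P :: "'m \<Rightarrow> 'x::finite \<Rightarrow> 'k::field"
  assumes order: "graded_monomial_order prec"
    and delta: "(\<lambda>j. if j = i then 1 else 0) \<in> code_lt P N"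
  shows "Poly_Mapping.keys (std_indicator prec P i) \<subseteq> std_monomials prec (vanishing_ideal (range P))"
    and "eval_mpol (std_indicator prec P i) (P j) = (if j = i then 1 else 0)"
proof -
  let ?I = "vanishing_ideal (range P)"
  obtain f where f: "f \<in> polys_lt N" "\<And>j. (if j = i then 1 else 0) = eval_mpol f (P j)"
    using code_ltE[OF delta] by blast
  obtain h where h: "Poly_Mapping.keys h \<subseteq> std_monomials prec ?I" "f - h \<in> ?I"
    using normal_form[OF order f(1)] by blast
  have h_eval: "eval_mpol h (P j) = (if j = i then 1 else 0)" for j
    using h(2) f(2)[of j] by (simp add: vanishing_ideal_def)
  have "std_indicator prec P i = h"
    unfolding std_indicator_def std_span_iff
  proof (rule the_equality)
    fix g assume g: "Poly_Mapping.keys g \<subseteq> std_monomials prec ?I \<and>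
      (\<forall>j. eval_mpol g (P j) = (if j = i then 1 else 0))"
    have "g - h = 0"
    proof (rule std_span_eq_zero[OF order])
      show "Poly_Mapping.keys (g - h) \<subseteq> std_monomials prec ?I"
      proof -
        have "Poly_Mapping.keys (g - h) \<subseteq> Poly_Mapping.keys g \<union> Poly_Mapping.keys h"
          by (auto simp: in_keys_iff lookup_minus)
        then show ?thesis using g h(1) by blast
      qed
      show "g - h \<in> ?I" using g h_eval by (simp add: vanishing_ideal_def)
    qed
    then show "g = h" by simp
  qed (use h h_eval in blast)
  then show "Poly_Mapping.keys (std_indicator prec P i) \<subseteq> std_monomials prec ?I"
    and "eval_mpol (std_indicator prec P i) (P j) = (if j = i then 1 else 0)"
    using h h_eval by auto
qed

text \<open>For a graded order the leading monomial has the largest degree, so it is not affected by terms of smaller degree.\<close>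

lemma lc_lower_perturbation:
  fixes f g h :: "('x::finite, 'k::field) mpol"
  assumes order: "graded_monomial_order prec"
    and f: "f \<notin> polys_lt r" and h: "h \<in> polys_lt r" and c: "c \<noteq> 0"
    and g: "g = Poly_Mapping.single 0 c * f + h"
  shows "lc prec g = c * lc prec f"
proof -
  let ?m = "lead_mon prec f"
  have nz: "f \<noteq> 0" using f by auto
  obtain n where n: "n \<in> Poly_Mapping.keys f" "r \<le> mdeg n"
    using f by (auto simp: polys_lt_def not_less)
  have deg: "r \<le> mdeg ?m"
    using n lead_mon(2)[OF order nz n(1)] graded_order_mdeg[OF order, of n ?m] by (cases "n = ?m") auto
  have lookup: "Poly_Mapping.lookup g ?m = c * Poly_Mapping.lookup f ?m"
    using h deg by (simp add: g lookup_add polys_lt_iff)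
  have "lead_mon prec g = ?m"
  proof (rule lead_mon_eqI[OF order])
    show "?m \<in> Poly_Mapping.keys g"
      using lookup c lead_mon(1)[OF order nz] by (simp add: in_keys_iff)
    fix n assume "n \<in> Poly_Mapping.keys g" "n \<noteq> ?m"
    then have "n \<in> Poly_Mapping.keys f \<or> n \<in> Poly_Mapping.keys h"
      by (auto simp: in_keys_iff g lookup_add)
    then show "prec n ?m"
    proof
      assume "n \<in> Poly_Mapping.keys f"
      then show ?thesis using lead_mon(2)[OF order nz] \<open>n \<noteq> ?m\<close> by blast
    next
      assume "n \<in> Poly_Mapping.keys h"
      then have "mdeg n < mdeg ?m" using h deg by (auto simp: polys_lt_def)
      then show ?thesis using order unfolding graded_monomial_order_def by blast
    qed
  qed
  then show ?thesis using lookup by (simp add: lc_def)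
qed


section \<open>Duality for Gorenstein point sets\<close>

text \<open>What the duality argument needs from the Gorenstein hypothesis: functions of socle type are unique up to a factor and
functions of smaller degree. The number \<open>r\<close> is the regularity index.\<close>

locale gorenstein_points =
  fixes P :: "'m::finite \<Rightarrow> 'x::finite \<Rightarrow> 'k::field" and r :: nat
  assumes full: "code_lt P (Suc r) = UNIV"
    and proper: "code_lt P r \<noteq> UNIV"
    and socle_unique: "socle P e v \<Longrightarrow> socle P e' v' \<Longrightarrow>
      e = e' \<and> (\<exists>c. c \<noteq> 0 \<and> (\<lambda>i. v' i - c * v i) \<in> code_lt P e)"
begin

definition delta :: "'m \<Rightarrow> 'm \<Rightarrow> 'k" where
  "delta i j = (if j = i then 1 else 0)"

lemma delta_sum: "(\<Sum>i\<in>UNIV. v i * delta i j) = v j"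
  by (simp add: delta_def if_distrib[where f = "\<lambda>x. _ * x"] cong: if_cong)

lemma code_lt_0: "code_lt P 0 = {\<lambda>i. 0}"
proof -
  have "polys_lt 0 = {0 :: ('x, 'k) mpol}"
    by (auto simp: polys_lt_iff intro: poly_mapping_eqI)
  then show ?thesis by (simp add: code_lt_def)
qed

lemma exists_degree:
  assumes "v i \<noteq> 0"
  shows "\<exists>e. v \<in> code_lt P (Suc e) \<and> v \<notin> code_lt P e"
proof -
  define n where "n = (LEAST n. v \<in> code_lt P n)"
  have n: "v \<in> code_lt P n" unfolding n_def by (rule LeastI[of _ "Suc r"]) (simp add: full)
  moreover have "n \<noteq> 0"
  proof
    assume "n = 0"
    then have "v = (\<lambda>i. 0)" using n by (simp add: code_lt_0)
    then show False using assms by simp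
  qed
  moreover have "v \<notin> code_lt P e" if "e < n" for e using that not_less_Least unfolding n_def by blast
  ultimately show ?thesis by (intro exI[of _ "n - 1"]) simp
qed

text \<open>A coordinate multiplies an indicator function by a scalar, so every indicator function is of socle type in its own
degree. As the indicator functions span all functions, one of them has degree \<open>r\<close>, and uniqueness forces this
degree on the others.\<close>

lemma socle_delta: "socle P r (delta i)"
proof -
  have "\<exists>e. socle P e (delta i)" for i
  proof -
    obtain e where e: "delta i \<in> code_lt P (Suc e)" "delta i \<notin> code_lt P e"
      using exists_degree[of "delta i" i] by (auto simp: delta_def)
    have "(\<lambda>k. P k j * delta i k) = (\<lambda>k. P i j * delta i k)" for j
      by (auto simp: delta_def)
    then show ?thesis using e code_lt_scale[OF e(1)] by (intro exI[of _ e]) (simp add: socle_def)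
  qed
  then obtain e where e: "\<And>i. socle P (e i) (delta i)" by metis
  obtain i0 where i0: "delta i0 \<notin> code_lt P r"
  proof (rule ccontr)
    assume "\<not> thesis"
    then have "delta i \<in> code_lt P r" for i using that by blast
    then have "(\<lambda>j. \<Sum>i\<in>UNIV. v i * delta i j) \<in> code_lt P r" for v
      by (intro code_lt_sum code_lt_scale)
    then show False using proper by (auto simp: delta_sum)
  qed
  have in_full: "delta i0 \<in> code_lt P (Suc r)" by (simp add: full)
  have in_e: "delta i0 \<in> code_lt P (Suc (e i0))" using e[of i0] by (simp add: socle_def)
  have "e i0 = r"
  proof (rule antisym)
    show "e i0 \<le> r"
    proof (rule ccontr)
      assume "\<not> e i0 \<le> r"
      then have "delta i0 \<in> code_lt P (e i0)"
        by (intro code_lt_mono[OF in_full]) simp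
      then show False using e[of i0] by (simp add: socle_def)
    qed
    show "r \<le> e i0"
    proof (rule ccontr)
      assume "\<not> r \<le> e i0"
      then have "delta i0 \<in> code_lt P r"
        by (intro code_lt_mono[OF in_e]) simp
      then show False using i0 by simp
    qed
  qed
  moreover have "e i = e i0" using socle_unique[OF e e] by blast
  ultimately show ?thesis using e by metis
qed

text \<open>A function that is not of socle type can be multiplied by some coordinate such that its degree goes up by one. The
process stops at the latest in degree \<open>r\<close>, and only at a function of socle type, whose degree must be \<open>r\<close>.\<close>

lemma multiple_outside:
  assumes "v \<in> code_lt P (Suc e)" "v \<notin> code_lt P e"
  shows "\<exists>g t. e + t = r \<and> g \<in> polys_lt (Suc t) \<and> (\<lambda>i. eval_mpol g (P i) * v i) \<notin> code_lt P r"
  using assms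
proof (induction "r - e" arbitrary: e v rule: less_induct)
  case less
  show ?case
  proof (cases "socle P e v")
    case True
    then have "e = r" using socle_unique[OF True socle_delta] by blast
    moreover have "1 \<in> polys_lt (Suc 0)"
      by (auto simp: polys_lt_iff lookup_one when_def)
    ultimately show ?thesis
      using less.prems by (intro exI[of _ 1] exI[of _ 0]) simp
  next
    case False
    then obtain j where j: "(\<lambda>i. P i j * v i) \<notin> code_lt P (Suc e)"
      using less.prems by (auto simp: socle_def)
    have "e < r"
      using j full code_lt_mono[of _ P "Suc r" "Suc e"] by (metis UNIV_I not_less Suc_le_mono)
    then have "r - Suc e < r - e" by simp
    from less.hyps[OF this code_lt_var_mult[OF less.prems(1)] j]
    obtain g t where g: "Suc e + t = r" "g \<in> polys_lt (Suc t)"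
      "(\<lambda>i. eval_mpol g (P i) * (P i j * v i)) \<notin> code_lt P r" by blast
    have "(\<lambda>i. eval_mpol (var j * g) (P i) * v i) = (\<lambda>i. eval_mpol g (P i) * (P i j * v i))"
      by (simp add: mult_ac)
    then show ?thesis
      using g polys_lt_var_mult[OF g(2), of j]
      by (intro exI[of _ "var j * g"] exI[of _ "Suc t"]) simp
  qed
qed

lemma delta_proportional:
  "\<exists>c. c \<noteq> 0 \<and> (\<lambda>k. delta i k - c * delta i0 k) \<in> code_lt P r"
  using socle_unique[OF socle_delta[of i0] socle_delta[of i]] by blast

text \<open>Expanding \<open>v\<close> in indicator functions and replacing each by a multiple of \<open>delta i0\<close> shows that, modulo
smaller degree, \<open>v\<close> is \<open>delta i0\<close> times the value of the functional.\<close>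

lemma code_lt_iff_functional:
  assumes c: "\<And>i. (\<lambda>k. delta i k - c i * delta i0 k) \<in> code_lt P r"
  shows "v \<in> code_lt P r \<longleftrightarrow> (\<Sum>i\<in>UNIV. c i * v i) = 0"
proof -
  let ?s = "\<Sum>i\<in>UNIV. c i * v i"
  have "(\<lambda>k. \<Sum>i\<in>UNIV. v i * (delta i k - c i * delta i0 k)) \<in> code_lt P r"
    using c by (intro code_lt_sum code_lt_scale)
  moreover have "(\<Sum>i\<in>UNIV. v i * (delta i k - c i * delta i0 k)) = v k - ?s * delta i0 k" for k
  proof -
    have "(\<Sum>i\<in>UNIV. v i * (c i * delta i0 k)) = ?s * delta i0 k"
      unfolding sum_distrib_right by (intro sum.cong) (simp_all add: mult_ac)
    then show ?thesis by (simp add: right_diff_distrib sum_subtractf delta_sum)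
  qed
  ultimately have diff: "(\<lambda>k. v k - ?s * delta i0 k) \<in> code_lt P r" by simp
  show ?thesis
  proof
    assume v: "v \<in> code_lt P r"
    show "?s = 0"
    proof (rule ccontr)
      assume s: "?s \<noteq> 0"
      have "(\<lambda>k. inverse ?s * (v k + (- 1) * (v k - ?s * delta i0 k))) \<in> code_lt P r"
        using v diff by (intro code_lt_scale code_lt_add)
      then have "delta i0 \<in> code_lt P r" using s by (simp add: mult.assoc[symmetric])
      then show False using socle_delta[of i0] by (simp add: socle_def)
    qed
  next
    assume "?s = 0"
    then show "v \<in> code_lt P r" using diff by simp
  qed
qed

text \<open>Two indicator functions are proportional modulo smaller degree. The same relation holds between their normal forms,
which are the standard indicator functions, so their leading coefficients have the same ratio.\<close>

lemma indicator_functional: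
  assumes order: "graded_monomial_order prec"
    and nonzero: "lc prec (std_indicator prec P i0) \<noteq> 0"
  shows "v \<in> code_lt P r \<longleftrightarrow> (\<Sum>i\<in>UNIV. lc prec (std_indicator prec P i) * v i) = 0"
proof -
  let ?I = "vanishing_ideal (range P)"
  let ?f = "std_indicator prec P"
  have "\<exists>c. \<forall>i. c i \<noteq> 0 \<and> (\<lambda>k. delta i k - c i * delta i0 k) \<in> code_lt P r"
    by (intro choice allI delta_proportional)
  then obtain c where c: "\<And>i. c i \<noteq> 0" "\<And>i. (\<lambda>k. delta i k - c i * delta i0 k) \<in> code_lt P r"
    by blast
  have "(\<lambda>j. if j = i then 1 else 0) \<in> code_lt P (Suc r)" for i by (simp add: full)
  note ind = std_indicator[OF order this]
  have f_eval: "eval_mpol (?f i) (P j) = delta i j" for i j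
    using ind(2)[of i j] by (simp add: delta_def)
  have lc: "lc prec (?f i) = c i * lc prec (?f i0)" for i
  proof -
    obtain h where h: "h \<in> polys_lt r" "\<And>k. delta i k - c i * delta i0 k = eval_mpol h (P k)"
      using code_ltE[OF c(2)] by blast
    obtain h' where h': "Poly_Mapping.keys h' \<subseteq> std_monomials prec ?I" "h' \<in> polys_lt r" "h - h' \<in> ?I"
      using normal_form[OF order h(1)] by blast
    let ?d = "?f i - (Poly_Mapping.single 0 (c i) * ?f i0 + h')"
    have h'_eval: "eval_mpol h' (P k) = delta i k - c i * delta i0 k" for k
      using h'(3) h(2)[of k] by (simp add: vanishing_ideal_def)
    have "?d = 0"
    proof (rule std_span_eq_zero[OF order])
      have "Poly_Mapping.keys ?d
          \<subseteq> Poly_Mapping.keys (?f i) \<union> Poly_Mapping.keys (?f i0) \<union> Poly_Mapping.keys h'"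
        by (auto simp: in_keys_iff lookup_minus lookup_add)
      then show "Poly_Mapping.keys ?d \<subseteq> std_monomials prec ?I"
        using ind(1)[of i] ind(1)[of i0] h'(1) by blast
      show "?d \<in> ?I" by (simp add: vanishing_ideal_def f_eval h'_eval)
    qed
    then have "?f i = Poly_Mapping.single 0 (c i) * ?f i0 + h'" by simp
    moreover have "?f i0 \<notin> polys_lt r"
    proof
      assume "?f i0 \<in> polys_lt r"
      then have "delta i0 \<in> code_lt P r" by (rule code_ltI) (simp add: f_eval)
      then show False using socle_delta[of i0] by (simp add: socle_def)
    qed
    ultimately show ?thesis using lc_lower_perturbation[OF order _ h'(2) c(1)] by blast
  qed
  have "(\<Sum>i\<in>UNIV. lc prec (?f i) * v i) = lc prec (?f i0) * (\<Sum>i\<in>UNIV. c i * v i)"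
    unfolding sum_distrib_left
  proof (intro sum.cong refl)
    show "lc prec (?f i) * v i = lc prec (?f i0) * (c i * v i)" for i
      unfolding lc[of i] by (simp only: mult_ac)
  qed
  then show ?thesis
    using nonzero unfolding code_lt_iff_functional[OF c(2), of v] by simp
qed

text \<open>Orthogonality of the code to itself is additivity of degrees. For the converse, a function of degree greater than
\<open>k\<close> is paired nontrivially with a polynomial of the complementary degree, which is at most \<open>k\<close>.\<close>

lemma self_dual_eval_code:
  assumes r: "r = Suc (2 * k)" and nonzero: "\<And>i. \<alpha> i \<noteq> 0"
    and functional: "\<And>v. v \<in> code_lt P r \<longleftrightarrow> (\<Sum>i\<in>UNIV. \<alpha> i ^ 2 * v i) = 0"
  shows "self_dual (code_mult \<alpha> (eval_code P k))"
  unfolding self_dual_def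
proof (intro equalityI subsetI)
  fix v assume "v \<in> code_mult \<alpha> (eval_code P k)"
  then obtain f where f: "f \<in> polys_lt (Suc k)" "\<And>i. v i = \<alpha> i * eval_mpol f (P i)"
    by (auto simp: code_mult_def eval_code_def polys_le_eq)
  show "v \<in> dual_code (code_mult \<alpha> (eval_code P k))"
    unfolding dual_code_def mem_Collect_eq
  proof
    fix c assume "c \<in> code_mult \<alpha> (eval_code P k)"
    then obtain w where w: "w \<in> code_lt P (Suc k)" "\<And>i. c i = \<alpha> i * w i"
      by (auto simp: code_mult_def eval_code_eq)
    have "(\<lambda>i. eval_mpol f (P i) * w i) \<in> code_lt P r"
      using code_lt_mult[OF f(1) w(1)] by (simp add: r mult_2)
    then have "(\<Sum>i\<in>UNIV. \<alpha> i ^ 2 * (eval_mpol f (P i) * w i)) = 0"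
      by (rule functional[THEN iffD1])
    then show "(\<Sum>i\<in>UNIV. v i * c i) = 0"
      by (simp add: f(2) w(2) power2_eq_square mult_ac)
  qed
next
  fix v assume v: "v \<in> dual_code (code_mult \<alpha> (eval_code P k))"
  \<comment> \<open>The codeword is \<open>\<alpha> w\<close>; the aim is that \<open>w\<close> has degree at most \<open>k\<close>.\<close>
  define w where "w i = v i / \<alpha> i" for i
  have v_eq: "v = (\<lambda>i. \<alpha> i * w i)" using nonzero by (simp add: w_def)
  have "w \<in> code_lt P (Suc k)"
  proof (rule ccontr)
    assume w: "w \<notin> code_lt P (Suc k)"
    have "w \<noteq> (\<lambda>i. 0)" using w code_lt_zero[of P "Suc k"] by auto
    then obtain i where "w i \<noteq> 0" by auto
    then obtain e where e: "w \<in> code_lt P (Suc e)" "w \<notin> code_lt P e"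
      using exists_degree by blast
    have "k < e" using w e(1) code_lt_mono[of w P "Suc e" "Suc k"] by (meson Suc_le_mono not_less)
    obtain g t where g: "e + t = r" "g \<in> polys_lt (Suc t)" "(\<lambda>i. eval_mpol g (P i) * w i) \<notin> code_lt P r"
      using multiple_outside[OF e] by blast
    have "g \<in> polys_lt (Suc k)" using g(1,2) \<open>k < e\<close> by (auto simp: r intro: polys_lt_mono)
    then have "(\<lambda>i. \<alpha> i * eval_mpol g (P i)) \<in> code_mult \<alpha> (eval_code P k)"
      by (auto simp: code_mult_def eval_code_def polys_le_eq)
    moreover have "(\<Sum>i\<in>UNIV. v i * c i) = 0" if "c \<in> code_mult \<alpha> (eval_code P k)" for c
      using v that by (simp add: dual_code_def)
    ultimately have "(\<Sum>i\<in>UNIV. v i * (\<alpha> i * eval_mpol g (P i))) = 0" by simp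
    then have "(\<Sum>i\<in>UNIV. \<alpha> i ^ 2 * (eval_mpol g (P i) * w i)) = 0"
      by (simp add: v_eq power2_eq_square mult_ac)
    then have "(\<lambda>i. eval_mpol g (P i) * w i) \<in> code_lt P r" by (rule functional[THEN iffD2])
    with g(3) show False by contradiction
  qed
  then show "v \<in> code_mult \<alpha> (eval_code P k)"
    unfolding code_mult_def eval_code_eq v_eq by blast
qed

end

theorem corollary6p16:
  fixes P :: "'m::finite \<Rightarrow> 's::finite \<Rightarrow> 'k::{field,finite}"
    and X :: "('s \<Rightarrow> 'k) set"
    and I :: "('s, 'k) mpol set"
    and r\<^sub>0 :: nat
    and prec :: "'s mon \<Rightarrow> 's mon \<Rightarrow> bool"
    and \<alpha> :: "'m \<Rightarrow> 'k"
  assumes "inj P"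
    and "X = range P"
    and "card X \<ge> 2"
    and "I = vanishing_ideal X"
    and "r\<^sub>0 = regularity_index X"
    and "graded_monomial_order prec"
    and "CHAR('k) = 2"
    and "odd r\<^sub>0"
    and "gorenstein I"
    and "\<And>i. \<alpha> i \<noteq> 0"
    and "\<And>i. \<alpha> i ^ 2 = lc prec (std_indicator prec P i)"
  shows "self_dual (code_mult \<alpha> (eval_code P ((r\<^sub>0 - 1) div 2)))"
proof -
  have gor: "gorenstein (vanishing_ideal (range P))" using assms by simp
  have r0: "r\<^sub>0 = regularity_index (range P)" "0 < r\<^sub>0" using assms by (simp_all add: odd_pos)
  interpret gorenstein_points P r\<^sub>0
  proof
    show "code_lt P (Suc r\<^sub>0) = UNIV" "code_lt P r\<^sub>0 \<noteq> UNIV"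
      using regularity_index_code[OF assms(1)] r0 by simp_all
    show "e = e' \<and> (\<exists>c. c \<noteq> 0 \<and> (\<lambda>i. v' i - c * v i) \<in> code_lt P e)"
      if "socle P e v" "socle P e' v'" for e v e' v'
      using gorenstein_socle_unique[OF assms(7) gor that] .
  qed
  have "lc prec (std_indicator prec P i) \<noteq> 0" for i
    using assms(10,11) by (metis power_not_zero)
  then have "v \<in> code_lt P r\<^sub>0 \<longleftrightarrow> (\<Sum>i\<in>UNIV. \<alpha> i ^ 2 * v i) = 0" for v
    unfolding assms(11) by (rule indicator_functional[OF assms(6)])
  moreover have "r\<^sub>0 = Suc (2 * ((r\<^sub>0 - 1) div 2))" using assms(8) by presburger
  ultimately show ?thesis using assms(10) by (intro self_dual_eval_code)
qed

end
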